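(* Let $\Sigma\subseteq\mathbb{C}$ be a nonempty compact set, let $L$ be a bounded band operator on $\ell^2(\mathbb{Z})$ with $LS=SL$, and let $\gamma\in\mathbb{Z}$. For $u\in\Sigma^{\mathbb{Z}}$ put $H(u):=L+S^\gamma M_u$. Let $b,b_1,b_2,\ldots\in\Sigma^{\mathbb{Z}}$, and put $A:=H(b)$ and $A_m:=H(b_m)$ for $m\in\mathbb{N}$. Suppose that \[ \forall N\in\mathbb{N}\ \exists m_0\in\mathbb{N}\ \forall m\ge m_0:\quad \mathcal{W}_N(b_m)=\mathcal{W}_N(b). \] Then, for all $\lambda\in\mathbb{C}$ and all $\varepsilon>0$, as $m\to\infty$, \[ \|(A_m-\lambda)^{-1}\|\to\|(A-\lambda)^{-1}\|\qquad\text{and}\qquad \sigma_\varepsilon(A_m)\to\sigma_\varepsilon(A)\ \text{in the Hausdorff distance.} \] If, in addition, $A_m$ (for all $m$) and $A$ are normal, then also $\sigma(A_m)\to\sigma(A)$ in the Hausdorff distance.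
   Context: $S$ is the shift on $\ell^2(\mathbb{Z})$, $(Sx)_n=x_{n-1}$, and $M_u$ is the multiplication operator $(M_ux)_n=u_nx_n$. A band operator on $\ell^2(\mathbb{Z})$ is an operator of the form $\sum_{k=-w}^{w}M_{a^{(k)}}S^k$ with $a^{(k)}\in\ell^\infty(\mathbb{Z})$ (equivalently, a matrix with finitely many nonzero bounded diagonals). For $u\in\Sigma^{\mathbb{Z}}$ and $N\in\mathbb{N}$, $\mathcal{W}_N(u)$ denotes the set of all subwords of length $N$ of $u$, i.e. the set of all words $(u(k),u(k+1),\dots,u(k+N-1))\in\Sigma^N$ with $k\in\mathbb{Z}$. For a bounded operator $T$, $\sigma(T)$ is its spectrum and, for $\varepsilon>0$, $\sigma_\varepsilon(T):=\{\lambda\in\mathbb{C}:\|(T-\lambda)^{-1}\|>1/\varepsilon\}$, with the convention $\|B^{-1}\|:=\infty$ if $B$ is not invertible (so $\|(A-\lambda)^{-1}\|$ may equal $\infty$). *)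

theory Defs
  imports "HOL-Analysis.Analysis"
begin

type_synonym seq = "int \<Rightarrow> complex"
type_synonym op = "seq \<Rightarrow> seq"

definition l2 :: "seq set" where
  "l2 = {x. (\<lambda>n. (norm (x n))\<^sup>2) summable_on UNIV}"

definition l2norm :: "seq \<Rightarrow> real" where
  "l2norm x = sqrt (infsum (\<lambda>n. (norm (x n))\<^sup>2) UNIV)"

definition l2inner :: "seq \<Rightarrow> seq \<Rightarrow> complex" where
  "l2inner x y = infsum (\<lambda>n. x n * cnj (y n)) UNIV"

definition shift :: "int \<Rightarrow> op" where
  "shift k x = (\<lambda>n. x (n - k))"

definition mult_op :: "seq \<Rightarrow> op" where
  "mult_op u x = (\<lambda>n. u n * x n)"

definition band_op :: "nat \<Rightarrow> (int \<Rightarrow> seq) \<Rightarrow> op" where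
  "band_op w a x = (\<lambda>n. \<Sum>k\<in>{-int w..int w}. a k n * x (n - k))"

definition is_bounded_band_op :: "op \<Rightarrow> bool" where
  "is_bounded_band_op L \<longleftrightarrow>
     (\<exists>w a. (\<forall>k. bounded (range (a k))) \<and> L = band_op w a)"

definition H_op :: "op \<Rightarrow> int \<Rightarrow> seq \<Rightarrow> op" where
  "H_op L \<gamma> u x = (\<lambda>n. L x n + shift \<gamma> (mult_op u x) n)"

definition words :: "nat \<Rightarrow> seq \<Rightarrow> complex list set" where
  "words N u = {map (\<lambda>i. u (k + int i)) [0..<N] | k. True}"

definition shift_op :: "op \<Rightarrow> complex \<Rightarrow> op" where
  "shift_op T z x = (\<lambda>n. T x n - z * x n)"

definition inv_norm :: "op \<Rightarrow> ereal" where
  "inv_norm B = (if bij_betw B l2 l2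
      then (SUP y\<in>{y\<in>l2. l2norm y \<le> 1}. ereal (l2norm (the_inv_into l2 B y)))
      else \<infinity>)"

definition resolvent_norm :: "op \<Rightarrow> complex \<Rightarrow> ereal" where
  "resolvent_norm T z = inv_norm (shift_op T z)"

definition l2_spectrum :: "op \<Rightarrow> complex set" where
  "l2_spectrum T = {z. \<not> bij_betw (shift_op T z) l2 l2}"

definition pseudospectrum :: "op \<Rightarrow> real \<Rightarrow> complex set" where
  "pseudospectrum T \<epsilon> = {z. resolvent_norm T z > ereal (1 / \<epsilon>)}"

definition is_normal_op :: "op \<Rightarrow> bool" where
  "is_normal_op T \<longleftrightarrow>
     (\<exists>T'. (\<forall>x\<in>l2. T' x \<in> l2) \<and>
           (\<forall>x\<in>l2. \<forall>y\<in>l2. l2inner (T x) y = l2inner x (T' y)) \<and>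
           (\<forall>x\<in>l2. T (T' x) = T' (T x)))"

text \<open>Hausdorff distance (extended-real valued, so unbounded sets give infinity).\<close>

definition hausdist_e :: "complex set \<Rightarrow> complex set \<Rightarrow> ereal" where
  "hausdist_e S T = max (SUP x\<in>S. ereal (infdist x T)) (SUP y\<in>T. ereal (infdist y S))"

end

theory Submission
  imports Defs
begin

text \<open>Write \<open>\<mu>\<^sub>A(z) = 1 / \<parallel>(A - z)\<inverse>\<parallel>\<close> (zero if \<open>z\<close> is in the spectrum). It is the minimum of the lower norms
  \<open>inf {\<parallel>(A - z)x\<parallel> | \<parallel>x\<parallel> = 1}\<close> of \<open>A - z\<close> and of its adjoint. For a band operator the squared lower
  norm is attained up to \<open>O(1/N)\<close> on vectors supported in a window of length \<open>N\<close>; as \<open>L\<close> is translation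
  invariant, it then depends only on the words of length \<open>N\<close>, whence \<open>\<mu>\<^bsub>A\<^sub>m\<^esub> \<rightarrow> \<mu>\<^sub>A\<close> pointwise, and locally
  uniformly because these functions are 1-Lipschitz. Averaging truncated Neumann series over roots of
  unity shows that \<open>\<mu>\<^sub>A\<close> has no positive local minimum, so the spectrum is nonempty and sublevel sets vary
  continuously, and that \<open>\<mu>\<^sub>A\<close> is at least the distance to the spectrum when \<open>A\<close> is normal.\<close>

section \<open>The Hilbert space of square-summable sequences\<close>

text \<open>Pointwise convergence of the functions \<mu> does not by itself make sublevel sets
  converge: if \<mu> of the limit were constantly \<epsilon> on an open set, small perturbations
  could put points of the approximating pseudospectra far away from the limiting one. Excluding
  positive local minima rules this out. The spectrum is even less stable; there a small value of
  \<mu> must force a nearby zero, at a rate uniform in m, which is what normality supplies. Both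
  facts come from one device. Let v nearly minimise |Tv| on the unit sphere and put x_0 = Tv, x_1 =
  v, x_2 = T^-1 v, and so on. Sums of the x_(j+1) with weights (r\<omega>)^j leave a bounded
  residual under T - r\<omega>, while their mean square norm over \<omega> is the sum of r^(2j)
  |x_(j+1)|^2. For r < \<mu> the term j = 1 is a gain that beats the small losses; for r = \<mu> and
  normal T no term decays, so the norm grows without bound. Only finite sums and norms occur, and no
  analyticity of the resolvent.\<close>

typedef ell2 = l2 morphisms coord Abs_ell2
proof
  show "(\<lambda>_. 0) \<in> l2" by (simp add: l2_def)
qed

lemma ell2_eqI: "(\<And>n. coord x n = coord y n) \<Longrightarrow> x = y"
  by (meson coord_inject ext)

lemma l2I_bound:
  assumes "y \<in> l2" "\<And>n. (norm (x n))\<^sup>2 \<le> c * (norm (y n))\<^sup>2"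
  shows "x \<in> l2"
  unfolding l2_def mem_Collect_eq
proof (rule summable_on_comparison_test)
  show "(\<lambda>n. c * (norm (y n))\<^sup>2) summable_on UNIV"
    using assms(1) by (intro summable_on_cmult_right) (simp add: l2_def)
qed (use assms in auto)

lemma norm_add_sq_le: "(norm (a + b))\<^sup>2 \<le> 2 * (norm a)\<^sup>2 + 2 * (norm b)\<^sup>2" for a b :: complex
proof -
  have "(norm (a + b))\<^sup>2 + (norm (a - b))\<^sup>2 = 2 * (norm a)\<^sup>2 + 2 * (norm b)\<^sup>2"
    by (simp add: power2_norm_eq_inner algebra_simps inner_commute)
  then show ?thesis by (smt (verit) zero_le_power2)
qed

lemma l2_add: "x \<in> l2 \<Longrightarrow> y \<in> l2 \<Longrightarrow> (\<lambda>n. x n + y n) \<in> l2"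
  unfolding l2_def mem_Collect_eq
  by (rule summable_on_comparison_test[where f="\<lambda>n. 2 * (norm (x n))\<^sup>2 + 2 * (norm (y n))\<^sup>2"])
     (auto intro!: summable_on_add summable_on_cmult_right norm_add_sq_le)

lemma l2_mult_const: "x \<in> l2 \<Longrightarrow> (\<lambda>n. c * x n) \<in> l2"
  by (rule l2I_bound[where c="(norm c)\<^sup>2"]) (auto simp: norm_mult power_mult_distrib)

lemma l2_uminus: "x \<in> l2 \<Longrightarrow> (\<lambda>n. - x n) \<in> l2"
  using l2_mult_const[of x "-1"] by simp

lemma l2_diff: "x \<in> l2 \<Longrightarrow> y \<in> l2 \<Longrightarrow> (\<lambda>n. x n - y n) \<in> l2"
  using l2_add[of x "\<lambda>n. - y n"] l2_uminus[of y] by simp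

lemma summable_l2_prod:
  assumes "x \<in> l2" "y \<in> l2"
  shows "(\<lambda>n. x n * cnj (y n)) summable_on UNIV"
proof (rule abs_summable_summable, rule summable_on_comparison_test)
  show "(\<lambda>n. (norm (x n))\<^sup>2 + (norm (y n))\<^sup>2) summable_on UNIV"
    using assms by (intro summable_on_add) (auto simp: l2_def)
  fix n
  show "norm (x n * cnj (y n)) \<le> (norm (x n))\<^sup>2 + (norm (y n))\<^sup>2"
    unfolding norm_mult complex_mod_cnj
    using sum_squares_bound[of "norm (x n)" "norm (y n)"]
      mult_nonneg_nonneg[OF norm_ge_zero[of "x n"] norm_ge_zero[of "y n"]] by linarith
qed auto

lemma summable_l2_inner:
  assumes "x \<in> l2" "y \<in> l2"
  shows "(\<lambda>n. inner (x n) (y n)) summable_on UNIV"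
  using summable_on_Re[OF summable_l2_prod[OF assms]] by (simp add: inner_complex_def)

text \<open>Only the real part of the complex inner product is kept: it gives the same norm and, for
  complex-linear operators, the same adjoints. Complex scalars return later as the maps
  \<open>cscale z\<close>.\<close>

instantiation ell2 :: real_inner
begin

definition "0 = Abs_ell2 (\<lambda>_. 0)"
definition "x + y = Abs_ell2 (\<lambda>n. coord x n + coord y n)"
definition "x - y = Abs_ell2 (\<lambda>n. coord x n - coord y n)"
definition "- x = Abs_ell2 (\<lambda>n. - coord x n)"
definition "scaleR r x = Abs_ell2 (\<lambda>n. of_real r * coord x n)"
definition "inner x y = infsum (\<lambda>n. inner (coord x n) (coord y n)) UNIV"
definition "norm x = sqrt (inner x x)" for x :: ell2
definition "dist x y = norm (x - y)" for x y :: ell2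
definition "sgn x = scaleR (inverse (norm x)) x" for x :: ell2
definition "(uniformity :: (ell2 \<times> ell2) filter) = (INF e\<in>{0 <..}. principal {(x, y). dist x y < e})"
definition "open (U :: ell2 set) \<longleftrightarrow> (\<forall>x\<in>U. \<forall>\<^sub>F (x', y) in uniformity. x' = x \<longrightarrow> y \<in> U)"

lemma coord_zero [simp]: "coord 0 n = 0"
  unfolding zero_ell2_def by (subst Abs_ell2_inverse) (simp_all add: l2_def)
lemma coord_add [simp]: "coord (x + y) n = coord x n + coord y n"
  unfolding plus_ell2_def by (subst Abs_ell2_inverse) (simp_all add: l2_add coord)
lemma coord_diff [simp]: "coord (x - y) n = coord x n - coord y n"
  unfolding minus_ell2_def by (subst Abs_ell2_inverse) (simp_all add: l2_diff coord)
lemma coord_uminus [simp]: "coord (- x) n = - coord x n"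
  unfolding uminus_ell2_def by (subst Abs_ell2_inverse) (simp_all add: l2_uminus coord)
lemma coord_scaleR [simp]: "coord (scaleR r x) n = of_real r * coord x n"
  unfolding scaleR_ell2_def by (subst Abs_ell2_inverse) (simp_all add: l2_mult_const coord)

lemma summable_inner: "(\<lambda>n. inner (coord x n) (coord y n)) summable_on UNIV"
  by (rule summable_l2_inner) (rule coord)+

instance
proof
  fix x y z :: ell2 and r s :: real
  show "inner (x + y) z = inner x z + inner y z"
    unfolding inner_ell2_def coord_add inner_add_left
    by (rule infsum_add) (rule summable_inner)+
  show "inner (r *\<^sub>R x) y = r * inner x y"
  proof -
    have "inner (coord (r *\<^sub>R x) n) (coord y n) = r * inner (coord x n) (coord y n)" for n
      by (simp add: scaleR_conv_of_real[symmetric])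
    then show ?thesis
      unfolding inner_ell2_def by (simp add: infsum_cmult_right')
  qed
  show "0 \<le> inner x x"
    unfolding inner_ell2_def by (rule infsum_nonneg) simp
  show "(inner x x = 0) = (x = 0)"
  proof
    assume "inner x x = 0"
    then have "inner (coord x n) (coord x n) = 0" for n
      unfolding inner_ell2_def
      by (intro nonneg_infsum_le_0D[where A=UNIV]) (auto intro: summable_inner)
    then show "x = 0" by (intro ell2_eqI) simp
  qed (simp add: inner_ell2_def)
  show "inner x y = inner y x"
    by (simp add: inner_ell2_def inner_commute)
qed (auto simp: dist_ell2_def sgn_ell2_def uniformity_ell2_def open_ell2_def norm_ell2_def
       algebra_simps intro!: ell2_eqI)

end

lemma summable_norm_sq: "(\<lambda>n. (norm (coord x n))\<^sup>2) summable_on UNIV"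
  using coord[of x] by (simp add: l2_def)

lemma norm_ell2_sq: "(norm x)\<^sup>2 = infsum (\<lambda>n. (norm (coord x n))\<^sup>2) UNIV"
  by (simp add: power2_norm_eq_inner inner_ell2_def)

lemma norm_ell2_eq: "norm x = l2norm (coord x)"
  by (simp add: norm_ell2_def inner_ell2_def l2norm_def power2_norm_eq_inner)

lemma finite_sum_le_norm_sq: "finite F \<Longrightarrow> (\<Sum>n\<in>F. (norm (coord x n))\<^sup>2) \<le> (norm x)\<^sup>2"
  unfolding norm_ell2_sq by (rule finite_sum_le_infsum) (auto intro: summable_norm_sq)

lemma norm_coord_le: "norm (coord x n) \<le> norm x"
  by (rule power2_le_imp_le) (use finite_sum_le_norm_sq[of "{n}" x] in simp_all)

lemma norm_sq_leI:
  assumes "\<And>F. finite F \<Longrightarrow> (\<Sum>n\<in>F. (norm (coord x n))\<^sup>2) \<le> c"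
  shows "(norm x)\<^sup>2 \<le> c"
  unfolding norm_ell2_sq by (rule infsum_le_finite_sums) (auto intro: summable_norm_sq assms)

lemma l2I_finite_sums:
  assumes "\<And>F. finite F \<Longrightarrow> (\<Sum>n\<in>F. (norm (x n))\<^sup>2) \<le> c"
  shows "x \<in> l2"
  unfolding l2_def mem_Collect_eq
  by (rule nonneg_bdd_above_summable_on) (auto intro!: bdd_aboveI[of _ c] assms)

text \<open>Coordinates of a Cauchy sequence converge, and bounds on finite partial sums survive the
  coordinatewise limit, so no limit is ever exchanged with an infinite sum.\<close>

instance ell2 :: banach
proof
  fix X :: "nat \<Rightarrow> ell2"
  assume X: "Cauchy X"
  have "Cauchy (\<lambda>k. coord (X k) n)" for n
  proof (rule metric_CauchyI)
    fix e :: real assume "e > 0"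
    then obtain M where M: "\<forall>i\<ge>M. \<forall>j\<ge>M. dist (X i) (X j) < e"
      using X by (meson metric_CauchyD)
    have "dist (coord (X i) n) (coord (X j) n) \<le> dist (X i) (X j)" for i j
      using norm_coord_le[of "X i - X j" n] by (simp add: dist_norm)
    then show "\<exists>M. \<forall>i\<ge>M. \<forall>j\<ge>M. dist (coord (X i) n) (coord (X j) n) < e"
      using M by (meson le_less_trans)
  qed
  then have "\<exists>l. (\<lambda>k. coord (X k) n) \<longlonglongrightarrow> l" for n
    by (simp add: Cauchy_convergent_iff convergent_def)
  then obtain l where l: "\<And>n. (\<lambda>k. coord (X k) n) \<longlonglongrightarrow> l n" by metis
  have key: "(\<Sum>n\<in>F. (norm (coord (X k) n - l n))\<^sup>2) \<le> e\<^sup>2"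
    if "finite F" "\<forall>i\<ge>M. \<forall>j\<ge>M. dist (X i) (X j) < e" "k \<ge> M" "e > 0" for F M k e
  proof (rule Lim_bounded[where M=M])
    show "(\<lambda>j. \<Sum>n\<in>F. (norm (coord (X k) n - coord (X j) n))\<^sup>2)
        \<longlonglongrightarrow> (\<Sum>n\<in>F. (norm (coord (X k) n - l n))\<^sup>2)"
      by (intro tendsto_intros l)
    show "\<forall>j\<ge>M. (\<Sum>n\<in>F. (norm (coord (X k) n - coord (X j) n))\<^sup>2) \<le> e\<^sup>2"
    proof (intro allI impI)
      fix j assume "j \<ge> M"
      then have "norm (X k - X j) \<le> e" using that by (auto simp: dist_norm intro: less_imp_le)
      then have "(norm (X k - X j))\<^sup>2 \<le> e\<^sup>2" by (simp add: power_mono)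
      then show "(\<Sum>n\<in>F. (norm (coord (X k) n - coord (X j) n))\<^sup>2) \<le> e\<^sup>2"
        using finite_sum_le_norm_sq[OF \<open>finite F\<close>, of "X k - X j"] by simp
    qed
  qed
  have mem: "(\<lambda>n. coord (X k) n - l n) \<in> l2"
    if "\<forall>i\<ge>M. \<forall>j\<ge>M. dist (X i) (X j) < e" "k \<ge> M" "e > 0" for M k e
    by (rule l2I_finite_sums[of _ "e\<^sup>2"]) (use key that in blast)
  obtain M0 where M0: "\<forall>i\<ge>M0. \<forall>j\<ge>M0. dist (X i) (X j) < 1"
    using X by (meson metric_CauchyD zero_less_one)
  have "l \<in> l2"
    using l2_diff[OF coord[of "X M0"] mem[OF M0 order_refl zero_less_one]] by simp
  then have L: "coord (Abs_ell2 l) = l" by (rule Abs_ell2_inverse)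
  have "X \<longlonglongrightarrow> Abs_ell2 l"
  proof (rule metric_LIMSEQ_I)
    fix e :: real assume "e > 0"
    then obtain M where M: "\<forall>i\<ge>M. \<forall>j\<ge>M. dist (X i) (X j) < e/2"
      using X by (meson metric_CauchyD half_gt_zero)
    have "dist (X k) (Abs_ell2 l) < e" if "k \<ge> M" for k
    proof -
      have "(norm (X k - Abs_ell2 l))\<^sup>2 \<le> (e/2)\<^sup>2"
        by (rule norm_sq_leI) (use key[OF _ M that] \<open>e > 0\<close> in \<open>simp add: L\<close>)
      then have "norm (X k - Abs_ell2 l) \<le> e/2"
        by (rule power2_le_imp_le) (use \<open>e > 0\<close> in simp)
      then show ?thesis using \<open>e > 0\<close> by (simp add: dist_norm)
    qed
    then show "\<exists>M. \<forall>k\<ge>M. dist (X k) (Abs_ell2 l) < e" by blast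
  qed
  then show "convergent X" by (auto simp: convergent_def)
qed

section \<open>Lower norms and invertibility\<close>

definition adjoint_pair :: "('a::real_inner \<Rightarrow> 'a) \<Rightarrow> ('a \<Rightarrow> 'a) \<Rightarrow> bool" where
  "adjoint_pair T S \<longleftrightarrow> bounded_linear T \<and> bounded_linear S \<and> (\<forall>x y. inner (T x) y = inner x (S y))"

lemma adjoint_pair_sym: "adjoint_pair T S \<Longrightarrow> adjoint_pair S T"
  unfolding adjoint_pair_def by (metis inner_commute)

text \<open>A Lax-Milgram argument: \<open>T \<circ> S\<close> is positive and, as \<open>S\<close>
  is bounded below, coercive. Hence the relaxed iteration
  \<open>y - t *\<^sub>R (T (S y) - f)\<close> is a contraction for small \<open>t\<close>, and its
  fixed point solves the equation.\<close>

lemma bounded_below_adjoint_imp_surj_comp: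
  fixes T S :: "'a::{real_inner,banach} \<Rightarrow> 'a"
  assumes adj: "adjoint_pair T S" and c: "c > 0" "\<And>y. c * norm y \<le> norm (S y)"
  shows "\<exists>w. T (S w) = f"
proof -
  interpret T: bounded_linear T using adj by (simp add: adjoint_pair_def)
  interpret S: bounded_linear S using adj by (simp add: adjoint_pair_def)
  obtain K0 where K0: "\<And>x. norm (T x) \<le> norm x * K0" using T.bounded by blast
  \<comment> \<open>The maximum ensures \<open>c \<le> K\<close>, so that
    \<open>1 - t * c\<^sup>2\<close> with \<open>t = 1 / K\<^sup>2\<close> is nonnegative and its
    root \<open>q\<close> can serve as the contraction factor.\<close>
  define K where "K = max K0 c"
  have K: "norm (T x) \<le> K * norm x" for x
    using K0[of x] mult_left_mono[of K0 K "norm x"] by (simp add: K_def mult.commute)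
  have K_pos: "K > 0" "c \<le> K" using c by (auto simp: K_def)
  define t where "t = 1 / K\<^sup>2"
  have t: "t > 0" "t * K\<^sup>2 = 1" "t * c\<^sup>2 \<le> 1"
    using K_pos c by (auto simp: t_def divide_simps power_mono)
  have contr: "(norm (u - t *\<^sub>R T (S u)))\<^sup>2 \<le> (1 - t * c\<^sup>2) * (norm u)\<^sup>2" for u
  proof -
    have TS: "inner (T (S u)) u = (norm (S u))\<^sup>2"
      using adj by (simp add: adjoint_pair_def power2_norm_eq_inner)
    have "(norm (T (S u)))\<^sup>2 \<le> (K * norm (S u))\<^sup>2" by (rule power_mono[OF K]) simp
    then have "t\<^sup>2 * (norm (T (S u)))\<^sup>2 \<le> t\<^sup>2 * (K * norm (S u))\<^sup>2"
      by (rule mult_left_mono) simp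
    also have "\<dots> = t * (t * K\<^sup>2) * (norm (S u))\<^sup>2"
      by (simp only: power_mult_distrib power2_eq_square mult_ac)
    finally have a: "t\<^sup>2 * (norm (T (S u)))\<^sup>2 \<le> t * (norm (S u))\<^sup>2" using t by simp
    have "(c * norm u)\<^sup>2 \<le> (norm (S u))\<^sup>2"
      by (rule power_mono[OF c(2)]) (use c in simp)
    then have b: "t * (c\<^sup>2 * (norm u)\<^sup>2) \<le> t * (norm (S u))\<^sup>2"
      using t by (simp add: power_mult_distrib)
    have "(norm (u - t *\<^sub>R T (S u)))\<^sup>2 = (norm u)\<^sup>2 - 2 * t * (norm (S u))\<^sup>2 + t\<^sup>2 * (norm (T (S u)))\<^sup>2"
    proof -
      have "(norm (u - t *\<^sub>R v))\<^sup>2 = (norm u)\<^sup>2 - 2 * t * inner v u + t\<^sup>2 * (norm v)\<^sup>2" for v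
        unfolding power2_norm_eq_inner
        by (simp add: inner_diff_left inner_diff_right inner_commute power2_eq_square algebra_simps)
      then show ?thesis unfolding TS[symmetric] .
    qed
    then show ?thesis using a b by (simp add: algebra_simps)
  qed
  define q where "q = sqrt (1 - t * c\<^sup>2)"
  have q: "0 \<le> q" "q < 1" "q\<^sup>2 = 1 - t * c\<^sup>2"
    using t c by (auto simp: q_def)
  define \<Phi> where "\<Phi> y = y - t *\<^sub>R (T (S y) - f)" for y
  have "dist (\<Phi> x) (\<Phi> y) \<le> q * dist x y" for x y
  proof -
    have "\<Phi> x - \<Phi> y = (x - y) - t *\<^sub>R T (S (x - y))"
      by (simp add: \<Phi>_def T.diff S.diff algebra_simps)
    then have "(norm (\<Phi> x - \<Phi> y))\<^sup>2 \<le> (q * norm (x - y))\<^sup>2"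
      using contr[of "x - y"] q by (simp add: power_mult_distrib)
    then show ?thesis unfolding dist_norm by (rule power2_le_imp_le) (use q in simp)
  qed
  then obtain w where "\<Phi> w = w" using banach_fix_type[OF q(1,2)] by metis
  then show ?thesis using t by (auto simp: \<Phi>_def intro!: exI[of _ w])
qed

text \<open>Banach-Steinhaus for the functionals \<open>inner x (z k)\<close>, by Baire category:
  the sets \<open>U j\<close> of points where some functional exceeds \<open>j\<close> are open and
  dense.\<close>

lemma uniform_boundedness_inner:
  fixes z :: "nat \<Rightarrow> 'a::{real_inner,banach}"
  assumes unb: "\<And>j. \<exists>k. norm (z k) > j"
  shows "\<exists>x. \<forall>j::nat. \<exists>k. \<bar>inner x (z k)\<bar> > real j"
proof -
  define U where "U j = {x. \<exists>k. \<bar>inner x (z k)\<bar> > real j}" for j :: nat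
  have op: "open (U j)" for j
  proof -
    have "U j = (\<Union>k. {x. \<bar>inner x (z k)\<bar> > real j})" by (auto simp: U_def)
    moreover have "open {x. \<bar>inner x (z k)\<bar> > real j}" for k
      by (intro open_Collect_less continuous_intros)
    ultimately show ?thesis by auto
  qed
  have dense: "closure (U j) = UNIV" for j
  proof -
    have "\<exists>y\<in>U j. dist y x < e" if e: "e > 0" for x e
    proof -
      \<comment> \<open>A step \<open>u\<close> of length \<open>e / 2\<close> along
        \<open>z k\<close> then satisfies \<open>inner u (z k) > 2 * real j\<close>, so
        \<open>x\<close> and \<open>x + u\<close> cannot both pair with \<open>z k\<close> to at
        most \<open>j\<close> in modulus.\<close>
      obtain k where k: "norm (z k) > 4 * real j / e" using unb by blast
      have "4 * real j / e \<ge> 0" using e by simp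
      then have zk: "norm (z k) > 0" using k by linarith
      define u where "u = (e / (2 * norm (z k))) *\<^sub>R z k"
      have nu: "norm u < e" using zk e by (simp add: u_def)
      have "inner u (z k) = (e / 2) * norm (z k)"
        using zk by (simp add: u_def power2_norm_eq_inner[symmetric] power2_eq_square)
      also have "\<dots> > 2 * real j" using k e by (simp add: field_simps)
      finally have "\<bar>inner x (z k)\<bar> > real j \<or> \<bar>inner (x + u) (z k)\<bar> > real j"
        by (simp add: inner_add_left) linarith
      then have "x \<in> U j \<or> x + u \<in> U j" by (auto simp: U_def)
      then show ?thesis using nu e by (metis add_diff_cancel_left' dist_norm dist_self)
    qed
    then show ?thesis by (auto simp: closure_approachable)
  qed
  have "Met_TC.mtopology closure_of \<Inter>(range U) = (UNIV :: 'a set)"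
  proof (rule Met_TC.metric_Baire_category)
    show "Met_TC.mcomplete TYPE('a)" by (simp add: mcomplete_iff_complete complete_UNIV)
  qed (use op dense in \<open>auto\<close>)
  then have "closure (\<Inter>(range U)) = UNIV" by simp
  then have "\<Inter>(range U) \<noteq> {}" by (metis UNIV_not_empty closure_empty)
  then show ?thesis by (auto simp: U_def)
qed

text \<open>Otherwise there are unbounded \<open>z k\<close> with
  \<open>norm (S (z k)) \<le> 1\<close>, and some \<open>x\<close> pairs unboundedly with them.
  Writing \<open>x = T u\<close> moves the pairing to \<open>inner u (S (z k))\<close>, which is at
  most \<open>norm u\<close>.\<close>

lemma surj_imp_adjoint_bounded_below:
  fixes T S :: "'a::{real_inner,banach} \<Rightarrow> 'a"
  assumes adj: "adjoint_pair T S" and "surj T"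
  shows "\<exists>c>0. \<forall>y. c * norm y \<le> norm (S y)"
proof (rule ccontr)
  assume "\<not> ?thesis"
  then have H: "\<forall>c>0. \<exists>y. norm (S y) < c * norm y" by (metis not_le)
  have "\<exists>y. norm (S y) \<le> 1 \<and> norm y > real k" for k
  proof -
    obtain y where y: "norm (S y) < 1 / (real k + 1) * norm y"
      using H by (metis add.commute of_nat_0_less_iff of_nat_Suc plus_1_eq_Suc zero_less_Suc zero_less_divide_1_iff)
    interpret S: bounded_linear S using adj by (simp add: adjoint_pair_def)
    define r where "r = (real k + 1) / norm y"
    have "norm y > 0" using y by (metis S.zero mult_zero_right norm_zero order_less_irrefl zero_less_norm_iff)
    then have "norm (S (r *\<^sub>R y)) \<le> 1" "norm (r *\<^sub>R y) > real k"
      using y by (auto simp: S.scaleR r_def field_simps)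
    then show ?thesis by blast
  qed
  then obtain z where z: "\<And>k. norm (S (z k)) \<le> 1" "\<And>k. norm (z k) > real k" by metis
  then have "\<exists>k. norm (z k) > j" for j by (meson order_less_trans reals_Archimedean2)
  then obtain x where x: "\<And>j::nat. \<exists>k. \<bar>inner x (z k)\<bar> > real j"
    using uniform_boundedness_inner by blast
  obtain u where u: "x = T u" using \<open>surj T\<close> by (metis surjD)
  have "\<bar>inner x (z k)\<bar> \<le> norm u" for k
  proof -
    have "inner x (z k) = inner u (S (z k))" using adj u by (simp add: adjoint_pair_def)
    also have "\<bar>\<dots>\<bar> \<le> norm u * norm (S (z k))" by (rule Cauchy_Schwarz_ineq2)
    also have "\<dots> \<le> norm u" using z(1)[of k] by (simp add: mult_left_le)
    finally show ?thesis .
  qed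
  then show False using x real_arch_simple[of "norm u"] by (meson not_le order_trans)
qed

text \<open>The bounded inverse theorem, by duality: surjectivity of \<open>T\<close> bounds
  \<open>S\<close> below, so \<open>T \<circ> S\<close> is onto; injectivity of \<open>T\<close>
  then makes \<open>S\<close> onto, and the preceding lemma applies with the roles
  exchanged.\<close>

lemma bij_imp_bounded_below:
  fixes T S :: "'a::{real_inner,banach} \<Rightarrow> 'a"
  assumes adj: "adjoint_pair T S" and "bij T"
  shows "\<exists>c>0. \<forall>x. c * norm x \<le> norm (T x)"
proof (rule surj_imp_adjoint_bounded_below[OF adjoint_pair_sym[OF adj]])
  obtain c where c: "c > 0" "\<And>y. c * norm y \<le> norm (S y)"
    using surj_imp_adjoint_bounded_below[OF adj] \<open>bij T\<close> by (auto simp: bij_def)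
  have "\<exists>w. S w = x" for x
    using bounded_below_adjoint_imp_surj_comp[OF adj c, of "T x"] \<open>bij T\<close>
    by (auto simp: bij_def inj_def)
  then show "surj S" unfolding surj_def by metis
qed

text \<open>With \<open>y = T u\<close>, the square of \<open>norm y\<close> is
  \<open>inner u (S y)\<close>, and \<open>c * norm u \<le> norm y\<close>. The constant
  \<open>c\<close> is carried over without loss, which is what makes the two lower norms equal for
  bijective \<open>T\<close>.\<close>

lemma surj_bounded_below_imp_adjoint:
  fixes T S :: "'a::real_inner \<Rightarrow> 'a"
  assumes adj: "adjoint_pair T S" and "surj T" and c: "c \<ge> 0" "\<And>x. c * norm x \<le> norm (T x)"
  shows "c * norm y \<le> norm (S y)"
proof (cases "y = 0")
  case False
  obtain u where u: "y = T u" using \<open>surj T\<close> by (metis surjD)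
  have "c * (norm y * norm y) = c * inner u (S y)"
    using adj u by (metis adjoint_pair_def power2_eq_square power2_norm_eq_inner)
  also have "\<dots> \<le> c * (norm u * norm (S y))"
    using c by (intro mult_left_mono norm_cauchy_schwarz) auto
  also have "\<dots> \<le> norm y * norm (S y)"
    using c(2)[of u] u by (metis mult.assoc mult_right_mono norm_ge_zero)
  finally show ?thesis using False by (simp add: mult_ac)
next
  case True
  interpret S: bounded_linear S using adj by (simp add: adjoint_pair_def)
  show ?thesis using True by (simp add: S.zero)
qed

text \<open>The minimum modulus of \<open>T\<close>, equal to 1 / ||T^-1|| for invertible
  \<open>T\<close>. A real infimum is meaningful only over a nonempty set, hence
  \<open>sphere_ell2_nonempty\<close> below.\<close>

definition lower_norm :: "('a::real_normed_vector \<Rightarrow> 'a) \<Rightarrow> real" where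
  "lower_norm T = (INF x\<in>sphere 0 1. norm (T x))"

lemma lower_norm_le: "norm x = 1 \<Longrightarrow> lower_norm T \<le> norm (T x)"
  unfolding lower_norm_def by (rule cINF_lower) (auto intro!: bdd_belowI[of _ 0])

lemma lower_norm_mult_le:
  assumes "bounded_linear T"
  shows "lower_norm T * norm x \<le> norm (T x)"
proof (cases "x = 0")
  case False
  interpret bounded_linear T by fact
  have "lower_norm T \<le> norm (T (x /\<^sub>R norm x))" using False by (intro lower_norm_le) simp
  then show ?thesis using False by (simp add: scaleR field_simps)
qed simp

section \<open>Lower norms on the sequence space and the norm of the inverse\<close>

definition delta :: "int \<Rightarrow> ell2" where
  "delta j = Abs_ell2 (\<lambda>n. if n = j then 1 else 0)"

lemma coord_delta: "coord (delta j) n = (if n = j then 1 else 0)"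
proof -
  have "(\<lambda>n. if n = j then 1 else 0) \<in> l2"
    unfolding l2_def mem_Collect_eq
    by (rule finite_nonzero_values_imp_summable_on) (rule finite_subset[of _ "{j}"], auto)
  then show ?thesis by (simp add: delta_def Abs_ell2_inverse)
qed

lemma norm_delta [simp]: "norm (delta j) = 1"
proof -
  have "(norm (delta j))\<^sup>2 = infsum (\<lambda>n. (norm (coord (delta j) n))\<^sup>2) {j}"
    unfolding norm_ell2_sq by (rule infsum_cong_neutral) (auto simp: coord_delta)
  then have "(norm (delta j))\<^sup>2 = 1" by (simp add: coord_delta)
  then show ?thesis by (simp add: power2_eq_1_iff) (use norm_ge_zero[of "delta j"] in linarith)
qed

lemma sphere_ell2_nonempty: "sphere (0::ell2) 1 \<noteq> {}"
proof -
  have "delta 0 \<in> sphere 0 1" by simp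
  then show ?thesis by blast
qed

lemma lower_normI:
  fixes T :: "ell2 \<Rightarrow> ell2"
  assumes "\<And>x. norm x = 1 \<Longrightarrow> c \<le> norm (T x)"
  shows "c \<le> lower_norm T"
  unfolding lower_norm_def using sphere_ell2_nonempty assms by (intro cINF_greatest) auto

lemma lower_norm_nonneg: "0 \<le> lower_norm T" for T :: "ell2 \<Rightarrow> ell2"
  by (rule lower_normI) simp

lemma lower_norm_approx:
  fixes T :: "ell2 \<Rightarrow> ell2"
  assumes "lower_norm T < c"
  shows "\<exists>x. norm x = 1 \<and> norm (T x) < c"
  using assms lower_normI[of c T] by (meson not_le)

lemma lower_norm_bij_adjoint:
  fixes T S :: "ell2 \<Rightarrow> ell2"
  assumes adj: "adjoint_pair T S" and "bij T"
  shows "lower_norm T > 0" "lower_norm S = lower_norm T"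
proof -
  have pos: "lower_norm T > 0" if T: "adjoint_pair T S" "bij T" for T S :: "ell2 \<Rightarrow> ell2"
  proof -
    obtain c where "c > 0" "\<forall>x. c * norm x \<le> norm (T x)"
      using bij_imp_bounded_below[OF T] by blast
    then have "c \<le> lower_norm T" by (intro lower_normI) (metis mult.right_neutral)
    then show ?thesis using \<open>c > 0\<close> by simp
  qed
  show "lower_norm T > 0" by (rule pos[OF assms])
  have le: "lower_norm T \<le> lower_norm S" if T: "adjoint_pair T S" "surj T" for T S :: "ell2 \<Rightarrow> ell2"
  proof (rule lower_normI)
    fix x :: ell2 assume x: "norm x = 1"
    have "bounded_linear T" using T by (simp add: adjoint_pair_def)
    from surj_bounded_below_imp_adjoint[OF T lower_norm_nonneg lower_norm_mult_le[OF this], of x]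
    show "lower_norm T \<le> norm (S x)" using x by simp
  qed
  obtain c where c: "c > 0" "\<And>x. c * norm x \<le> norm (T x)"
    using bij_imp_bounded_below[OF assms] by blast
  have "surj S"
  proof -
    have "\<exists>w. S (T w) = f" for f
      by (rule bounded_below_adjoint_imp_surj_comp[OF adjoint_pair_sym[OF adj] c])
    then show ?thesis unfolding surj_def by metis
  qed
  then show "lower_norm S = lower_norm T"
    using le[OF adj bij_is_surj[OF \<open>bij T\<close>]] le[OF adjoint_pair_sym[OF adj]] by (simp add: antisym)
qed

text \<open>The bound for \<open>T\<close> gives injectivity, the bound for \<open>S\<close>
  surjectivity of \<open>T\<close>. An isometry that is not onto shows that the first alone does not
  suffice.\<close>

lemma bij_if_lower_norms_pos:
  fixes T S :: "ell2 \<Rightarrow> ell2"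
  assumes adj: "adjoint_pair T S" and T: "lower_norm T > 0" and S: "lower_norm S > 0"
  shows "bij T"
proof (rule bijI)
  have bl: "bounded_linear T" "bounded_linear S" using adj by (auto simp: adjoint_pair_def)
  interpret bounded_linear T by fact
  have "\<exists>w. T (S w) = f" for f
    by (rule bounded_below_adjoint_imp_surj_comp[OF adj S lower_norm_mult_le[OF bl(2)]])
  then show "surj T" unfolding surj_def by metis
  show "inj T"
  proof (rule injI)
    fix x y assume "T x = T y"
    then have "T (x - y) = 0" by (simp add: diff)
    then have "lower_norm T * norm (x - y) \<le> 0" using lower_norm_mult_le[OF bl(1), of "x - y"] by simp
    then show "x = y" using T by (simp add: mult_le_0_iff)
  qed
qed

lemma bij_betw_l2_iff:
  assumes "\<And>x. coord (T x) = B (coord x)"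
  shows "bij_betw B l2 l2 \<longleftrightarrow> bij T"
proof -
  have c: "bij_betw coord UNIV l2"
    unfolding bij_betw_def inj_on_def
    using type_definition.Rep_range[OF type_definition_ell2] by (simp add: coord_inject)
  have "bij_betw B l2 l2 \<longleftrightarrow> bij_betw (B \<circ> coord) UNIV l2"
    by (rule bij_betw_comp_iff[OF c])
  also have "B \<circ> coord = coord \<circ> T" using assms by auto
  also have "bij_betw (coord \<circ> T) UNIV l2 \<longleftrightarrow> bij T"
    by (rule bij_betw_comp_iff2[OF c, symmetric]) auto
  finally show ?thesis .
qed

text \<open>In \<open>ereal\<close> the inverse of 0 is \<open>\<infinity>\<close>, which agrees
  with the convention for non-invertible operators, so one formula covers both cases.\<close>

lemma inv_norm_eq:
  assumes B: "\<And>x. coord (T x) = B (coord x)" and adj: "adjoint_pair T S"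
  shows "inv_norm B = inverse (ereal (min (lower_norm T) (lower_norm S)))"
proof (cases "bij T")
  case False
  then have "\<not> (lower_norm T > 0 \<and> lower_norm S > 0)" using bij_if_lower_norms_pos[OF adj] by blast
  then have "min (lower_norm T) (lower_norm S) = 0"
    using lower_norm_nonneg[of T] lower_norm_nonneg[of S] by linarith
  then show ?thesis using False by (simp add: inv_norm_def bij_betw_l2_iff[of T B, OF B])
next
  case True
  define \<mu> where "\<mu> = lower_norm T"
  have \<mu>: "\<mu> > 0" "min (lower_norm T) (lower_norm S) = \<mu>"
    using lower_norm_bij_adjoint[OF adj True] by (auto simp: \<mu>_def)
  have bl: "bounded_linear T" using adj by (auto simp: adjoint_pair_def)
  interpret bounded_linear T by fact
  have bB: "bij_betw B l2 l2" using True by (simp add: bij_betw_l2_iff[of T B, OF B])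
  have inv: "the_inv_into l2 B (coord (T x)) = coord x" for x
    unfolding B by (rule the_inv_into_f_f) (use bB coord[of x] in \<open>auto simp: bij_betw_def\<close>)
  have "(SUP y\<in>{y \<in> l2. l2norm y \<le> 1}. ereal (l2norm (the_inv_into l2 B y))) = ereal (1 / \<mu>)"
  proof (rule antisym)
    show "(SUP y\<in>{y \<in> l2. l2norm y \<le> 1}. ereal (l2norm (the_inv_into l2 B y))) \<le> ereal (1 / \<mu>)"
    proof (rule SUP_least)
      fix y assume y: "y \<in> {y \<in> l2. l2norm y \<le> 1}"
      then obtain x where x: "y = coord (T x)"
        proof -
        have "coord (Abs_ell2 y) = y" using y by (simp add: Abs_ell2_inverse)
        moreover obtain x where "T x = Abs_ell2 y" using True by (metis bij_pointE)
        ultimately show ?thesis using that[of x] by simp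
      qed
      have "\<mu> * norm x \<le> norm (T x)" unfolding \<mu>_def by (rule lower_norm_mult_le) fact
      also have "\<dots> \<le> 1" using y x by (simp add: norm_ell2_eq)
      finally have "norm x \<le> 1 / \<mu>" using \<mu> by (simp add: field_simps)
      then show "ereal (l2norm (the_inv_into l2 B y)) \<le> ereal (1 / \<mu>)"
        by (simp add: x inv norm_ell2_eq)
    qed
    \<comment> \<open>The infimum defining \<open>\<mu>\<close> need not be attained, so the
      supremum is bounded below by \<open>1 / c\<close> for every \<open>c > \<mu>\<close>, and then
      \<open>c\<close> decreases to \<open>\<mu>\<close>.\<close>
    have *: "ereal (1 / c) \<le> (SUP y\<in>{y \<in> l2. l2norm y \<le> 1}. ereal (l2norm (the_inv_into l2 B y)))"
      if c: "c > \<mu>" for c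
    proof -
      obtain x where x: "norm x = 1" "norm (T x) < c"
        using lower_norm_approx c unfolding \<mu>_def by blast
      define x' where "x' = (1 / c) *\<^sub>R x"
      have cpos: "c > 0" using c \<mu> by simp
      have "norm (T x') \<le> 1" using x cpos by (simp add: x'_def scaleR)
      then have mem: "coord (T x') \<in> {y \<in> l2. l2norm y \<le> 1}"
        using coord by (simp add: norm_ell2_eq)
      have "1 / c = l2norm (the_inv_into l2 B (coord (T x')))"
        unfolding inv norm_ell2_eq[symmetric] x'_def norm_scaleR using x cpos by simp
      then show ?thesis using SUP_upper[OF mem, of "\<lambda>y. ereal (l2norm (the_inv_into l2 B y))"] by simp
    qed
    show "ereal (1 / \<mu>) \<le> (SUP y\<in>{y \<in> l2. l2norm y \<le> 1}. ereal (l2norm (the_inv_into l2 B y)))"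
    proof (rule tendsto_upperbound)
      have "((\<lambda>c. 1 / c) \<longlongrightarrow> 1 / \<mu>) (at_right \<mu>)" using \<mu> by (auto intro!: tendsto_intros)
      then show "((\<lambda>c. ereal (1 / c)) \<longlongrightarrow> ereal (1 / \<mu>)) (at_right \<mu>)" by simp
      show "\<forall>\<^sub>F c in at_right \<mu>. ereal (1 / c)
          \<le> (SUP y\<in>{y \<in> l2. l2norm y \<le> 1}. ereal (l2norm (the_inv_into l2 B y)))"
        using eventually_at_right_less[of \<mu>] by eventually_elim (rule *)
    qed simp
  qed
  then show ?thesis using bB \<mu> by (simp add: inv_norm_def inverse_eq_divide)
qed

section \<open>Band operators and localization\<close>

lemma has_sum_sum:
  fixes f :: "'i \<Rightarrow> 'a \<Rightarrow> 'b::{topological_comm_monoid_add}"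
  assumes "\<And>i. i \<in> I \<Longrightarrow> (f i has_sum s i) A"
  shows "((\<lambda>x. \<Sum>i\<in>I. f i x) has_sum (\<Sum>i\<in>I. s i)) A"
  using assms by (induction I rule: infinite_finite_induct) (auto intro!: has_sum_add)

lemma has_sum_shift_int:
  fixes f :: "int \<Rightarrow> 'b::topological_comm_monoid_add"
  shows "((\<lambda>n. f (n - k)) has_sum s) UNIV \<longleftrightarrow> (f has_sum s) UNIV"
  by (rule has_sum_reindex_bij_betw[OF bij_betwI[where g="\<lambda>n. n + k"]]) auto

lemma l2_shift: "x \<in> l2 \<Longrightarrow> (\<lambda>n. x (n - k)) \<in> l2"
  unfolding l2_def mem_Collect_eq summable_on_def
  using has_sum_shift_int[of "\<lambda>n. (norm (x n))\<^sup>2" k] by auto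

lemma has_sum_norm_sq: "((\<lambda>n. (norm (coord x n))\<^sup>2) has_sum (norm x)\<^sup>2) UNIV"
  unfolding norm_ell2_sq by (rule has_sum_infsum) (rule summable_norm_sq)

section \<open>Translations, truncations and complex scalars\<close>

definition translate :: "int \<Rightarrow> ell2 \<Rightarrow> ell2" where
  "translate s x = Abs_ell2 (\<lambda>n. coord x (n - s))"

lemma coord_translate [simp]: "coord (translate s x) n = coord x (n - s)"
  unfolding translate_def by (subst Abs_ell2_inverse) (auto intro: l2_shift coord)

lemma norm_translate [simp]: "norm (translate s x) = norm x"
proof -
  have "((\<lambda>n. (norm (coord (translate s x) n))\<^sup>2) has_sum (norm x)\<^sup>2) UNIV"
    using has_sum_norm_sq[of x] has_sum_shift_int[of "\<lambda>n. (norm (coord x n))\<^sup>2" s] by simp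
  then have "(norm (translate s x))\<^sup>2 = (norm x)\<^sup>2"
    using has_sum_norm_sq has_sum_unique by blast
  then show ?thesis by simp
qed

definition trunc :: "int \<Rightarrow> nat \<Rightarrow> ell2 \<Rightarrow> ell2" where
  "trunc p N x = Abs_ell2 (\<lambda>n. if p \<le> n \<and> n < p + int N then coord x n else 0)"

lemma coord_trunc: "coord (trunc p N x) n = (if p \<le> n \<and> n < p + int N then coord x n else 0)"
  unfolding trunc_def
  by (subst Abs_ell2_inverse) (auto intro!: l2I_bound[OF coord[of x], where c=1])

definition cscale :: "complex \<Rightarrow> ell2 \<Rightarrow> ell2" where
  "cscale z x = Abs_ell2 (\<lambda>n. z * coord x n)"

lemma coord_cscale [simp]: "coord (cscale z x) n = z * coord x n"
  unfolding cscale_def by (subst Abs_ell2_inverse) (auto intro: l2_mult_const coord)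

lemma norm_cscale [simp]: "norm (cscale z x) = norm z * norm x"
proof -
  have "(norm (cscale z x))\<^sup>2 = (norm z * norm x)\<^sup>2"
    unfolding norm_ell2_sq power_mult_distrib by (simp add: norm_mult power_mult_distrib infsum_cmult_right')
  then show ?thesis by simp
qed

lemma inner_cscale: "inner (cscale z x) y = inner x (cscale (cnj z) y)"
  unfolding inner_ell2_def by (rule infsum_cong) (simp add: inner_complex_def algebra_simps)

text \<open>The diagonals of the conjugate transpose: its entry in row \<open>n\<close>, column
  \<open>n - k\<close> is the conjugate of the original entry in row \<open>n - k\<close>, column
  \<open>n\<close>, which lies on diagonal \<open>- k\<close>.\<close>

definition adj_coef :: "(int \<Rightarrow> int \<Rightarrow> complex) \<Rightarrow> int \<Rightarrow> int \<Rightarrow> complex" where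
  "adj_coef a k n = cnj (a (- k) (n - k))"

definition bandT :: "nat \<Rightarrow> (int \<Rightarrow> int \<Rightarrow> complex) \<Rightarrow> ell2 \<Rightarrow> ell2" where
  "bandT w a x = Abs_ell2 (band_op w a (coord x))"

text \<open>The Cauchy-Schwarz majorant, over \<open>2 * w + 1\<close> diagonals bounded by
  \<open>C\<close>, of the squared modulus of the \<open>n\<close>-th coordinate of the image of
  \<open>x\<close>. It is summable in \<open>n\<close>.\<close>

definition local_mass :: "nat \<Rightarrow> real \<Rightarrow> ell2 \<Rightarrow> int \<Rightarrow> real" where
  "local_mass w C x n = C\<^sup>2 * real (2 * w + 1) * (\<Sum>k\<in>{-int w..int w}. (norm (coord x (n - k)))\<^sup>2)"

lemma local_mass_nonneg: "0 \<le> local_mass w C x n"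
  by (auto simp: local_mass_def intro!: mult_nonneg_nonneg sum_nonneg)

lemma has_sum_local_mass:
  "(local_mass w C x has_sum (C\<^sup>2 * (real (2 * w + 1))\<^sup>2 * (norm x)\<^sup>2)) UNIV"
proof -
  have "((\<lambda>n. \<Sum>k\<in>{-int w..int w}. (norm (coord x (n - k)))\<^sup>2) has_sum
      (\<Sum>k\<in>{-int w..int w}. (norm x)\<^sup>2)) UNIV"
    using has_sum_norm_sq[of x] has_sum_shift_int[of "\<lambda>n. (norm (coord x n))\<^sup>2"]
    by (intro has_sum_sum) auto
  from has_sum_cmult_right[OF this, of "C\<^sup>2 * real (2 * w + 1)"]
  show ?thesis unfolding local_mass_def by (simp add: power2_eq_square mult_ac add_ac)
qed

context
  fixes w :: nat and C :: real and a :: "int \<Rightarrow> int \<Rightarrow> complex"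
  assumes bnd: "\<And>k n. norm (a k n) \<le> C"
begin

text \<open>Allowing any \<open>y\<close> dominated by \<open>x\<close> makes one majorant serve all
  truncations of \<open>x\<close>, whatever the window.\<close>

lemma band_op_sq_le:
  assumes "\<And>m. norm (y m) \<le> norm (coord x m)"
  shows "(norm (band_op w a y n))\<^sup>2 \<le> local_mass w C x n"
proof -
  have C: "C \<ge> 0" using bnd[of 0 0] norm_ge_zero order_trans by blast
  have "norm (band_op w a y n) \<le> (\<Sum>k\<in>{-int w..int w}. C * norm (coord x (n - k)))"
    unfolding band_op_def
    by (rule sum_norm_le) (auto simp: norm_mult intro!: mult_mono bnd assms C)
  also have "\<dots> = C * (\<Sum>k\<in>{-int w..int w}. norm (coord x (n - k)))"
    by (simp add: sum_distrib_left)
  finally have "(norm (band_op w a y n))\<^sup>2 \<le> (C * (\<Sum>k\<in>{-int w..int w}. norm (coord x (n - k))))\<^sup>2"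
    by (rule power_mono) simp
  also have "\<dots> \<le> C\<^sup>2 * (real (2 * w + 1) * (\<Sum>k\<in>{-int w..int w}. (norm (coord x (n - k)))\<^sup>2))"
    unfolding power_mult_distrib
  proof (rule mult_left_mono)
    have "(\<Sum>k\<in>{-int w..int w}. norm (coord x (n - k)))\<^sup>2
      \<le> (\<Sum>k\<in>{-int w..int w}. (norm (coord x (n - k)))\<^sup>2) * real (card {-int w..int w})"
      by (rule sum_squared_le_sum_of_squares)
    then show "(\<Sum>k\<in>{-int w..int w}. norm (coord x (n - k)))\<^sup>2
      \<le> real (2 * w + 1) * (\<Sum>k\<in>{-int w..int w}. (norm (coord x (n - k)))\<^sup>2)"
      by (simp add: mult_ac add_ac)
  qed simp
  finally show ?thesis by (simp add: local_mass_def mult_ac)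
qed

lemma coord_bandT: "coord (bandT w a x) = band_op w a (coord x)"
  unfolding bandT_def
proof (rule Abs_ell2_inverse)
  show "band_op w a (coord x) \<in> l2"
    unfolding l2_def mem_Collect_eq
    by (rule summable_on_comparison_test[OF has_sum_imp_summable[OF has_sum_local_mass[of w C x]]])
       (auto intro: band_op_sq_le)
qed

lemma norm_bandT_le: "norm (bandT w a x) \<le> C * real (2 * w + 1) * norm x"
proof -
  have C: "C \<ge> 0" using bnd[of 0 0] norm_ge_zero order_trans by blast
  have "(norm (bandT w a x))\<^sup>2 \<le> C\<^sup>2 * (real (2 * w + 1))\<^sup>2 * (norm x)\<^sup>2"
    by (rule has_sum_mono[OF has_sum_norm_sq has_sum_local_mass])
       (simp add: coord_bandT band_op_sq_le)
  then have "(norm (bandT w a x))\<^sup>2 \<le> (C * real (2 * w + 1) * norm x)\<^sup>2"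
    by (simp only: power_mult_distrib)
  then show ?thesis by (rule power2_le_imp_le) (use C in simp)
qed

lemma bounded_linear_bandT: "bounded_linear (bandT w a)"
proof (rule bounded_linear_intro)
  show "norm (bandT w a x) \<le> norm x * (C * real (2 * w + 1))" for x
    using norm_bandT_le[of x] by (simp add: mult_ac)
qed (auto intro!: ell2_eqI simp: coord_bandT band_op_def sum.distrib sum_distrib_left algebra_simps)

lemma bandT_cscale: "bandT w a (cscale z x) = cscale z (bandT w a x)"
  by (rule ell2_eqI) (simp add: coord_bandT band_op_def sum_distrib_left mult_ac)

lemma norm_adj_coef_le: "norm (adj_coef a k n) \<le> C"
  by (simp add: adj_coef_def bnd)

end

text \<open>Each diagonal is reindexed separately by \<open>m = n - k\<close>; as there are finitely
  many diagonals, the infinite sums are combined only by finite addition.\<close>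

lemma inner_bandT:
  assumes bnd: "\<And>k n. norm (a k n) \<le> C"
  shows "inner (bandT w a x) y = inner x (bandT w (adj_coef a) y)"
proof -
  let ?W = "{-int w..int w}"
  let ?f = "\<lambda>k m. inner (a k (m + k) * coord x m) (coord y (m + k))"
  have l2a: "(\<lambda>m. a k (m + k) * coord x m) \<in> l2" for k
  proof (rule l2I_bound[OF coord[of x], where c="C\<^sup>2"])
    fix n
    show "(norm (a k (n + k) * coord x n))\<^sup>2 \<le> C\<^sup>2 * (norm (coord x n))\<^sup>2"
      unfolding norm_mult power_mult_distrib
      by (intro mult_right_mono power_mono) (auto simp: bnd)
  qed
  have sm: "(?f k has_sum infsum (?f k) UNIV) UNIV" for k
    by (rule has_sum_infsum, rule summable_l2_inner[OF l2a])
       (use l2_shift[OF coord[of y], of "- k"] in simp)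
  have "((\<lambda>n. ?f k (n - k)) has_sum infsum (?f k) UNIV) UNIV" for k
    using has_sum_shift_int[of "?f k" k, THEN iffD2, OF sm[of k]] .
  then have "((\<lambda>n. \<Sum>k\<in>?W. ?f k (n - k)) has_sum (\<Sum>k\<in>?W. infsum (?f k) UNIV)) UNIV"
    by (intro has_sum_sum)
  then have 1: "inner (bandT w a x) y = (\<Sum>k\<in>?W. infsum (?f k) UNIV)"
    unfolding inner_ell2_def
    by (intro infsumI) (simp add: coord_bandT[OF bnd] band_op_def inner_sum_left)
  have "((\<lambda>m. \<Sum>k\<in>?W. ?f k m) has_sum (\<Sum>k\<in>?W. infsum (?f k) UNIV)) UNIV"
    by (intro has_sum_sum sm)
  moreover have "(\<Sum>k\<in>?W. ?f k m) = inner (coord x m) (coord (bandT w (adj_coef a) y) m)" for m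
  proof -
    have "(\<Sum>k\<in>?W. ?f k m) = (\<Sum>k\<in>?W. ?f (- k) m)"
      by (rule sum.reindex_bij_witness[where i=uminus and j=uminus]) auto
    also have "\<dots> = (\<Sum>k\<in>?W. inner (coord x m) (adj_coef a k m * coord y (m - k)))"
      by (rule sum.cong) (auto simp: adj_coef_def inner_complex_def algebra_simps)
    also have "\<dots> = inner (coord x m) (coord (bandT w (adj_coef a) y) m)"
      by (simp add: coord_bandT[OF norm_adj_coef_le[of a, OF bnd]] band_op_def inner_sum_right)
    finally show ?thesis .
  qed
  ultimately have "inner x (bandT w (adj_coef a) y) = (\<Sum>k\<in>?W. infsum (?f k) UNIV)"
    unfolding inner_ell2_def by (intro infsumI) simp
  then show ?thesis using 1 by simp
qed

lemma adjoint_pair_bandT: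
  assumes "\<And>k n. norm (a k n) \<le> C"
  shows "adjoint_pair (bandT w a) (bandT w (adj_coef a))"
  unfolding adjoint_pair_def
  using bounded_linear_bandT[of a C w, OF assms] inner_bandT[of a C w, OF assms]
    bounded_linear_bandT[of "adj_coef a" C w, OF norm_adj_coef_le[of a, OF assms]] by blast

text \<open>The index \<open>n - k\<close> is the column of the entry \<open>a k n\<close>, so the
  condition concerns exactly the entries that act on vectors supported in the window. One
  translation \<open>s\<close> must match all diagonals at once.\<close>

definition locally_similar :: "nat \<Rightarrow> nat \<Rightarrow> (int \<Rightarrow> int \<Rightarrow> complex) \<Rightarrow> (int \<Rightarrow> int \<Rightarrow> complex) \<Rightarrow> bool" where
  "locally_similar w N a a' \<longleftrightarrow> (\<forall>p. \<exists>s. \<forall>k\<in>{-int w..int w}. \<forall>n.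
     p \<le> n - k \<and> n - k < p + int N \<longrightarrow> a' k (n + s) = a k n)"

text \<open>Each \<open>n\<close> lies in exactly \<open>N\<close> windows, those starting in
  \<open>{n - int N<..n}\<close>. Restricting to finite \<open>G\<close> keeps the sum over window
  positions finite.\<close>

lemma sum_trunc_norm_sq_ge:
  assumes "finite G"
  shows "real N * (\<Sum>n\<in>G. (norm (coord x n))\<^sup>2)
    \<le> (\<Sum>p\<in>(\<Union>n\<in>G. {n - int N<..n}). (norm (trunc p N x))\<^sup>2)"
proof -
  define F where "F = (\<Union>n\<in>G. {n - int N<..n})"
  have F: "finite F" using assms by (simp add: F_def)
  have "real N * (norm (coord x n))\<^sup>2 = (\<Sum>p\<in>F. (norm (coord (trunc p N x) n))\<^sup>2)" if "n \<in> G" for n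
  proof -
    have "(\<Sum>p\<in>F. (norm (coord (trunc p N x) n))\<^sup>2) = (\<Sum>p\<in>{n - int N<..n}. (norm (coord x n))\<^sup>2)"
      by (rule sum.mono_neutral_cong_right[OF F]) (use that in \<open>auto simp: F_def coord_trunc\<close>)
    then show ?thesis by simp
  qed
  then have "real N * (\<Sum>n\<in>G. (norm (coord x n))\<^sup>2) = (\<Sum>n\<in>G. \<Sum>p\<in>F. (norm (coord (trunc p N x) n))\<^sup>2)"
    by (simp add: sum_distrib_left)
  also have "\<dots> = (\<Sum>p\<in>F. \<Sum>n\<in>G. (norm (coord (trunc p N x) n))\<^sup>2)" by (rule sum.swap)
  also have "\<dots> \<le> (\<Sum>p\<in>F. (norm (trunc p N x))\<^sup>2)"
    by (intro sum_mono finite_sum_le_norm_sq assms)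
  finally show ?thesis by (simp add: F_def)
qed

section \<open>Comparison of lower norms by summing over all windows\<close>

context
  fixes w N :: nat and C :: real and a :: "int \<Rightarrow> int \<Rightarrow> complex"
  assumes bnd: "\<And>k n. norm (a k n) \<le> C"
begin

text \<open>For fixed \<open>n\<close> the window \<open>{p..<p + N}\<close> either contains the whole \<open>w\<close>-neighbourhood
  of \<open>n\<close> or misses it, except for at most \<open>4 w\<close> values of \<open>p\<close>; this makes the boundary terms
  negligible against the \<open>N\<close> windows that see \<open>n\<close>.\<close>

lemma band_trunc_cases:
  "(norm (coord (bandT w a (trunc p N x)) n))\<^sup>2
    \<le> (if p \<in> {n - int N<..n} then (norm (coord (bandT w a x) n))\<^sup>2 else 0)
      + (if p \<in> {n - int w - int N<..n + int w - int N} \<union> {n - int w<..n + int w}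
         then local_mass w C x n else 0)"
proof -
  consider "p \<in> {n - int w - int N<..n + int w - int N} \<union> {n - int w<..n + int w}"
    | "p \<le> n - int w - int N" | "p > n + int w" | "p > n + int w - int N" "p \<le> n - int w"
    by fastforce
  then show ?thesis
  proof cases
    case 1
    have "(norm (coord (bandT w a (trunc p N x)) n))\<^sup>2 \<le> local_mass w C x n"
      unfolding coord_bandT[of a C w, OF bnd]
      by (rule band_op_sq_le[OF bnd]) (simp add: coord_trunc)
    then show ?thesis using 1 by (auto intro: add_increasing)
  next
    case 4
    have "coord (bandT w a (trunc p N x)) n = coord (bandT w a x) n"
      unfolding coord_bandT[of a C w, OF bnd] band_op_def
      by (rule sum.cong) (use 4 in \<open>auto simp: coord_trunc\<close>)
    then show ?thesis using 4 by auto
  next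
    case 2
    have "coord (bandT w a (trunc p N x)) n = 0"
      unfolding coord_bandT[of a C w, OF bnd] band_op_def
      by (rule sum.neutral) (use 2 in \<open>auto simp: coord_trunc\<close>)
    then show ?thesis by (simp add: local_mass_nonneg)
  next
    case 3
    have "coord (bandT w a (trunc p N x)) n = 0"
      unfolding coord_bandT[of a C w, OF bnd] band_op_def
      by (rule sum.neutral) (use 3 in \<open>auto simp: coord_trunc\<close>)
    then show ?thesis by (simp add: local_mass_nonneg)
  qed
qed

lemma sum_band_trunc_le:
  assumes F: "finite F"
  shows "(\<Sum>p\<in>F. (norm (bandT w a (trunc p N x)))\<^sup>2)
    \<le> real N * (norm (bandT w a x))\<^sup>2 + 4 * real w * (C\<^sup>2 * (real (2 * w + 1))\<^sup>2 * (norm x)\<^sup>2)"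
proof -
  have pt: "(\<Sum>p\<in>F. (norm (coord (bandT w a (trunc p N x)) n))\<^sup>2)
    \<le> real N * (norm (coord (bandT w a x) n))\<^sup>2 + 4 * real w * local_mass w C x n" for n
  proof -
    let ?A = "{n - int N<..n}"
    let ?B = "{n - int w - int N<..n + int w - int N} \<union> {n - int w<..n + int w}"
    let ?t = "(norm (coord (bandT w a x) n))\<^sup>2"
    have "card (F \<inter> ?A) \<le> card ?A" by (rule card_mono) auto
    then have cA: "real (card (F \<inter> ?A)) \<le> real N" by simp
    have "card (F \<inter> ?B) \<le> card ?B" by (rule card_mono) auto
    also have "\<dots> \<le> 4 * w"
      by (rule order_trans[OF card_Un_le]) simp
    finally have cB: "real (card (F \<inter> ?B)) \<le> 4 * real w" by linarith
    have "(\<Sum>p\<in>F. (norm (coord (bandT w a (trunc p N x)) n))\<^sup>2)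
      \<le> (\<Sum>p\<in>F. (if p \<in> ?A then ?t else 0) + (if p \<in> ?B then local_mass w C x n else 0))"
      by (rule sum_mono) (rule band_trunc_cases)
    also have "\<dots> = real (card (F \<inter> ?A)) * ?t + real (card (F \<inter> ?B)) * local_mass w C x n"
      unfolding sum.distrib by (simp only: sum.inter_restrict[OF F, symmetric] sum_constant)
    also have "\<dots> \<le> real N * ?t + 4 * real w * local_mass w C x n"
      using cA cB by (intro add_mono mult_right_mono) (auto simp: local_mass_nonneg)
    finally show ?thesis .
  qed
  show ?thesis
  proof (rule has_sum_mono)
    show "((\<lambda>n. \<Sum>p\<in>F. (norm (coord (bandT w a (trunc p N x)) n))\<^sup>2) has_sum
       (\<Sum>p\<in>F. (norm (bandT w a (trunc p N x)))\<^sup>2)) UNIV"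
      by (intro has_sum_sum has_sum_norm_sq)
    show "((\<lambda>n. real N * (norm (coord (bandT w a x) n))\<^sup>2 + 4 * real w * local_mass w C x n) has_sum
       real N * (norm (bandT w a x))\<^sup>2 + 4 * real w * (C\<^sup>2 * (real (2 * w + 1))\<^sup>2 * (norm x)\<^sup>2)) UNIV"
      by (intro has_sum_add has_sum_cmult_right has_sum_norm_sq has_sum_local_mass)
  qed (rule pt)
qed

text \<open>On a vector supported in a window, \<open>a\<close> acts as a translate of
  \<open>a'\<close> does, so the lower bound \<open>c\<close> of \<open>a'\<close> holds there for
  \<open>a\<close>. Summing its square over all windows replaces any search for a good one: the left
  side collects \<open>N\<close> copies of each coordinate, the right side \<open>N\<close> copies
  of the image plus boundary terms independent of \<open>N\<close>. Division by \<open>N\<close>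
  leaves the error.\<close>

lemma lower_norm_localized:
  assumes bnd': "\<And>k n. norm (a' k n) \<le> C" and sim: "locally_similar w N a a'" and N: "N > 0"
  shows "(lower_norm (bandT w a'))\<^sup>2
    \<le> (lower_norm (bandT w a))\<^sup>2 + 4 * real w * C\<^sup>2 * (real (2 * w + 1))\<^sup>2 / real N"
proof -
  define c where "c = lower_norm (bandT w a')"
  define K where "K = 4 * real w * C\<^sup>2 * (real (2 * w + 1))\<^sup>2"
  have c0: "c \<ge> 0" unfolding c_def by (rule lower_norm_nonneg)
  have loc: "c * norm (trunc p N x) \<le> norm (bandT w a (trunc p N x))" for p x
  proof -
    obtain s where s: "\<And>k n. \<lbrakk>-int w \<le> k; k \<le> int w; p \<le> n - k; n - k < p + int N\<rbrakk> \<Longrightarrow> a' k (n + s) = a k n"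
      using sim unfolding locally_similar_def by (meson atLeastAtMost_iff)
    have "bandT w a' (translate s (trunc p N x)) = translate s (bandT w a (trunc p N x))"
    proof (rule ell2_eqI)
      fix n
      have "a' k n * coord (trunc p N x) (n - k - s) = a k (n - s) * coord (trunc p N x) (n - s - k)"
        if "k \<in> {-int w..int w}" for k
        using s[of k "n - s"] that by (auto simp: coord_trunc algebra_simps)
      then show "coord (bandT w a' (translate s (trunc p N x))) n
          = coord (translate s (bandT w a (trunc p N x))) n"
        by (simp add: coord_bandT[of a C w, OF bnd] coord_bandT[of a' C w, OF bnd'] band_op_def)
    qed
    moreover have "c * norm (translate s (trunc p N x)) \<le> norm (bandT w a' (translate s (trunc p N x)))"
      unfolding c_def by (rule lower_norm_mult_le) (rule bounded_linear_bandT[OF bnd'])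
    ultimately show ?thesis by simp
  qed
  have main: "c\<^sup>2 \<le> (norm (bandT w a x))\<^sup>2 + K / real N" if x: "norm x = 1" for x
  proof (cases "c = 0")
    case False
    have c2: "c\<^sup>2 * real N > 0" using False N by simp
    have "(norm x)\<^sup>2 \<le> (real N * (norm (bandT w a x))\<^sup>2 + K * (norm x)\<^sup>2) / (c\<^sup>2 * real N)"
    proof (rule norm_sq_leI)
      fix G :: "int set" assume G: "finite G"
      let ?F = "\<Union>n\<in>G. {n - int N<..n}"
      have "c\<^sup>2 * (real N * (\<Sum>n\<in>G. (norm (coord x n))\<^sup>2)) \<le> c\<^sup>2 * (\<Sum>p\<in>?F. (norm (trunc p N x))\<^sup>2)"
        by (intro mult_left_mono sum_trunc_norm_sq_ge G) simp
      also have "\<dots> = (\<Sum>p\<in>?F. (c * norm (trunc p N x))\<^sup>2)"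
        by (simp add: sum_distrib_left power_mult_distrib)
      also have "\<dots> \<le> (\<Sum>p\<in>?F. (norm (bandT w a (trunc p N x)))\<^sup>2)"
        by (intro sum_mono power_mono loc) (simp add: c0)
      also have "\<dots> \<le> real N * (norm (bandT w a x))\<^sup>2 + K * (norm x)\<^sup>2"
        using sum_band_trunc_le[of ?F x] G by (simp add: K_def mult_ac)
      finally show "(\<Sum>n\<in>G. (norm (coord x n))\<^sup>2)
          \<le> (real N * (norm (bandT w a x))\<^sup>2 + K * (norm x)\<^sup>2) / (c\<^sup>2 * real N)"
        using c2 by (simp add: pos_le_divide_eq mult_ac)
    qed
    then have "c\<^sup>2 * real N \<le> real N * (norm (bandT w a x))\<^sup>2 + K"
      using c2 x by (simp add: pos_le_divide_eq)
    then show ?thesis using N by (simp add: field_simps)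
  qed (simp add: K_def)
  \<comment> \<open>The radicand may be negative; the real \<open>sqrt\<close> is odd, so the bound
    is then trivial.\<close>
  have "sqrt (c\<^sup>2 - K / real N) \<le> lower_norm (bandT w a)"
  proof (rule lower_normI)
    fix x :: ell2 assume "norm x = 1"
    from main[OF this] show "sqrt (c\<^sup>2 - K / real N) \<le> norm (bandT w a x)"
      by (intro real_le_lsqrt) auto
  qed
  then have "c\<^sup>2 - K / real N \<le> (lower_norm (bandT w a))\<^sup>2"
    by (rule sqrt_le_D)
  then show ?thesis by (simp add: c_def K_def)
qed

end

section \<open>Truncated Neumann series over roots of unity\<close>

lemma sum_roots_unity_orthogonal:
  assumes n: "n > 0" and ij: "i < n" "j < n"
  shows "(\<Sum>k<n. cis (2 * pi * real k / real n) ^ i * cnj (cis (2 * pi * real k / real n) ^ j))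
    = (if i = j then of_nat n else 0)"
proof -
  define \<theta> where "\<theta> = 2 * pi * (real i - real j) / real n"
  have eq: "cis (2 * pi * real k / real n) ^ i * cnj (cis (2 * pi * real k / real n) ^ j) = cis \<theta> ^ k" for k
  proof -
    have "cis t ^ i * cnj (cis t ^ j) = cis (real i * t - real j * t)" for t
      by (simp only: complex_cnj_power cis_cnj Complex.DeMoivre cis_mult mult_minus_right add_uminus_conv_diff)
    then have "cis (2 * pi * real k / real n) ^ i * cnj (cis (2 * pi * real k / real n) ^ j)
      = cis (real i * (2 * pi * real k / real n) - real j * (2 * pi * real k / real n))" .
    also have "real i * (2 * pi * real k / real n) - real j * (2 * pi * real k / real n) = real k * \<theta>"
      using n by (simp add: \<theta>_def field_simps)
    finally show ?thesis by (simp add: Complex.DeMoivre)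
  qed
  show ?thesis
  proof (cases "i = j")
    case False
    have "cis \<theta> \<noteq> 1"
    proof
      assume "cis \<theta> = 1"
      then have "cos \<theta> = 1" by (simp add: complex_eq_iff)
      then obtain m :: int where m: "\<theta> = of_int m * 2 * pi" using cos_one_2pi_int by blast
      then have "2 * pi * ((real i - real j) / real n) = 2 * pi * real_of_int m"
        by (simp add: \<theta>_def)
      then have "(real i - real j) / real n = real_of_int m"
        unfolding mult_cancel_left by simp
      then have "real_of_int (int i - int j) = real_of_int (m * int n)"
        using n by (simp add: field_simps)
      then have "int i - int j = m * int n" by (simp only: of_int_eq_iff)
      then have "int n dvd int i - int j" by simp
      then show False using ij False dvd_imp_le_int[of "int i - int j" "int n"] by auto
    qed
    moreover have "cis \<theta> ^ n = 1"
    proof -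
      have "real n * \<theta> = 2 * pi * real_of_int (int i - int j)" using n by (simp add: \<theta>_def)
      then show ?thesis by (simp add: Complex.DeMoivre cis_multiple_2pi)
    qed
    ultimately show ?thesis using False unfolding eq by (simp add: geometric_sum)
  next
    case True
    then show ?thesis unfolding eq by (simp add: \<theta>_def)
  qed
qed

lemma parseval_roots_unity:
  fixes c :: "nat \<Rightarrow> complex"
  assumes n: "n > 0"
  shows "(\<Sum>k<n. (norm (\<Sum>j<n. cis (2 * pi * real k / real n) ^ j * c j))\<^sup>2) = real n * (\<Sum>j<n. (norm (c j))\<^sup>2)"
proof -
  let ?\<omega> = "\<lambda>k. cis (2 * pi * real k / real n)"
  have "complex_of_real (\<Sum>k<n. (norm (\<Sum>j<n. ?\<omega> k ^ j * c j))\<^sup>2)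
    = (\<Sum>k<n. \<Sum>i<n. \<Sum>j<n. (?\<omega> k ^ i * cnj (?\<omega> k ^ j)) * (c i * cnj (c j)))"
  proof -
    have "complex_of_real ((norm (\<Sum>j<n. ?\<omega> k ^ j * c j))\<^sup>2)
      = (\<Sum>i<n. \<Sum>j<n. (?\<omega> k ^ i * cnj (?\<omega> k ^ j)) * (c i * cnj (c j)))" for k
      unfolding complex_norm_square cnj_sum sum_product complex_cnj_mult
      by (intro sum.cong refl) (simp only: mult_ac)
    then show ?thesis by simp
  qed
  also have "\<dots> = (\<Sum>i<n. \<Sum>k<n. \<Sum>j<n. (?\<omega> k ^ i * cnj (?\<omega> k ^ j)) * (c i * cnj (c j)))"
    by (rule sum.swap)
  also have "\<dots> = (\<Sum>i<n. \<Sum>j<n. \<Sum>k<n. (?\<omega> k ^ i * cnj (?\<omega> k ^ j)) * (c i * cnj (c j)))"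
    by (rule sum.cong[OF refl]) (rule sum.swap)
  also have "\<dots> = (\<Sum>i<n. \<Sum>j<n. (if i = j then of_nat n else 0) * (c i * cnj (c j)))"
  proof -
    have "(\<Sum>k<n. (?\<omega> k ^ i * cnj (?\<omega> k ^ j)) * (c i * cnj (c j)))
      = (if i = j then of_nat n else 0) * (c i * cnj (c j))" if "i < n" "j < n" for i j
      unfolding sum_distrib_right[symmetric] sum_roots_unity_orthogonal[OF n that] ..
    then show ?thesis by simp
  qed
  also have "\<dots> = (\<Sum>i<n. of_nat n * (c i * cnj (c i)))"
  proof -
    have "(\<Sum>j<n. (if i = j then of_nat n else 0) * (c i * cnj (c j))) = of_nat n * (c i * cnj (c i))"
      if "i < n" for i
    proof -
      have "(\<Sum>j<n. (if i = j then of_nat n else 0) * (c i * cnj (c j)))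
        = (\<Sum>j<n. if i = j then of_nat n * (c i * cnj (c j)) else 0)"
        by (rule sum.cong) auto
      then show ?thesis using that by simp
    qed
    then show ?thesis by simp
  qed
  also have "\<dots> = complex_of_real (real n * (\<Sum>j<n. (norm (c j))\<^sup>2))"
    by (simp add: complex_norm_square[symmetric] sum_distrib_left)
  finally show ?thesis by (simp only: of_real_eq_iff)
qed

lemma coord_sum: "coord (\<Sum>i\<in>I. f i) n = (\<Sum>i\<in>I. coord (f i) n)"
  by (induction I rule: infinite_finite_induct) auto

text \<open>If \<open>T (x (Suc j)) = x j\<close>, the vectors \<open>y\<^sub>\<omega> = (\<Sum>j<n. (r\<omega>)\<^sup>j x\<^sub>j\<^sub>+\<^sub>1)\<close> are truncated Neumann series
  for \<open>(T - r\<omega>)\<inverse> x\<^sub>0\<close>; over the \<open>n\<close>-th roots of unity \<open>\<omega>\<close> their squared norms average to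
  the sum on the left of the second inequality.\<close>

lemma truncated_neumann_average:
  fixes x :: "nat \<Rightarrow> ell2"
  assumes n: "n > 0" and r: "r \<ge> 0" and T: "bounded_linear T" and Tc: "\<And>z x. T (cscale z x) = cscale z (T x)"
    and x: "\<And>j. T (x (Suc j)) = x j"
  shows "\<exists>z y. norm z = r \<and> norm (T y - cscale z y) \<le> norm (x 0) + r ^ n * norm (x n)
    \<and> (\<Sum>j<n. r ^ (2 * j) * (norm (x (Suc j)))\<^sup>2) \<le> (norm y)\<^sup>2"
proof -
  interpret bounded_linear T by fact
  define \<omega> where "\<omega> k = cis (2 * pi * real k / real n)" for k
  define y where "y z = (\<Sum>j<n. cscale (z ^ j) (x (Suc j)))" for z
  have Ty: "T (y z) - cscale z (y z) = x 0 - cscale (z ^ n) (x n)" for z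
  proof -
    have "T (y z) = (\<Sum>j<n. cscale (z ^ j) (x j))" by (simp add: y_def sum Tc x)
    moreover have "cscale z (y z) = (\<Sum>j<n. cscale (z ^ Suc j) (x (Suc j)))"
      by (rule ell2_eqI) (simp add: y_def coord_sum sum_distrib_left mult_ac)
    moreover have "(\<Sum>j<n. cscale (z ^ j) (x j)) - (\<Sum>j<n. cscale (z ^ Suc j) (x (Suc j)))
        = cscale (z ^ 0) (x 0) - cscale (z ^ n) (x n)"
      unfolding sum_subtractf[symmetric] by (rule sum_lessThan_telescope')
    moreover have "cscale (z ^ 0) (x 0) = x 0" by (rule ell2_eqI) simp
    ultimately show ?thesis by simp
  qed
  let ?S = "\<Sum>j<n. r ^ (2 * j) * (norm (x (Suc j)))\<^sup>2"
  \<comment> \<open>The mean over the roots of unity is computed in each coordinate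
    \<open>p\<close>, where the scalar Parseval identity applies, and then summed over
    \<open>p\<close>.\<close>
  have "((\<lambda>p. \<Sum>k<n. (norm (coord (y (r * \<omega> k)) p))\<^sup>2) has_sum (\<Sum>k<n. (norm (y (r * \<omega> k)))\<^sup>2)) UNIV"
    by (intro has_sum_sum has_sum_norm_sq)
  moreover have "((\<lambda>p. real n * (\<Sum>j<n. r ^ (2 * j) * (norm (coord (x (Suc j)) p))\<^sup>2)) has_sum real n * ?S) UNIV"
    by (intro has_sum_cmult_right has_sum_sum has_sum_norm_sq)
  moreover have "(\<Sum>k<n. (norm (coord (y (r * \<omega> k)) p))\<^sup>2)
      = real n * (\<Sum>j<n. r ^ (2 * j) * (norm (coord (x (Suc j)) p))\<^sup>2)" for p
  proof -
    have "coord (y (r * \<omega> k)) p = (\<Sum>j<n. \<omega> k ^ j * (of_real r ^ j * coord (x (Suc j)) p))" for k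
      by (simp add: y_def coord_sum power_mult_distrib mult_ac)
    moreover have "(norm (of_real r ^ j * coord (x (Suc j)) p))\<^sup>2 = r ^ (2 * j) * (norm (coord (x (Suc j)) p))\<^sup>2" for j
      using r by (simp add: norm_mult norm_power power_mult_distrib power_mult[symmetric] mult.commute)
    ultimately show ?thesis
      using parseval_roots_unity[OF n, of "\<lambda>j. of_real r ^ j * coord (x (Suc j)) p"]
      by (simp add: \<omega>_def)
  qed
  ultimately have avg: "(\<Sum>k<n. (norm (y (r * \<omega> k)))\<^sup>2) = real n * ?S"
    by (simp add: has_sum_unique)
  \<comment> \<open>Some root of unity does at least as well as the mean; the residual bound holds
    for all of them.\<close>
  have "\<exists>k<n. ?S \<le> (norm (y (r * \<omega> k)))\<^sup>2"
  proof (rule ccontr)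
    assume "\<not> ?thesis"
    then have "(\<Sum>k<n. (norm (y (r * \<omega> k)))\<^sup>2) < (\<Sum>k<n. ?S)"
      using n by (intro sum_strict_mono) (auto simp: not_le)
    then show False using avg by simp
  qed
  then obtain k where k: "?S \<le> (norm (y (r * \<omega> k)))\<^sup>2" by blast
  have nz: "norm (r * \<omega> k) = r" using r by (simp add: \<omega>_def norm_mult)
  have "norm (x 0 - cscale ((r * \<omega> k) ^ n) (x n)) \<le> norm (x 0) + r ^ n * norm (x n)"
    using norm_triangle_ineq4[of "x 0" "cscale ((r * \<omega> k) ^ n) (x n)"] nz by (simp add: norm_power)
  then have "norm (T (y (r * \<omega> k)) - cscale (r * \<omega> k) (y (r * \<omega> k))) \<le> norm (x 0) + r ^ n * norm (x n)"
    unfolding Ty .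
  then show ?thesis using k nz by blast
qed

section \<open>Backward orbits: absence of positive local minima, and the normal case\<close>

lemma bounded_linear_cscale: "bounded_linear (cscale z)"
  by (rule bounded_linear_intro[where K="norm z"])
     (auto intro!: ell2_eqI simp: algebra_simps)

lemma bounded_linear_diff_cscale:
  "bounded_linear T \<Longrightarrow> bounded_linear (\<lambda>x. T x - cscale z x)"
  by (intro bounded_linear_sub bounded_linear_cscale)

text \<open>The orbit is indexed so that the nearly minimising vector \<open>v\<close> is entry 1
  and its image \<open>T v\<close>, the main part of the residual, is entry 0.\<close>

definition inverse_orbit :: "(ell2 \<Rightarrow> ell2) \<Rightarrow> ell2 \<Rightarrow> nat \<Rightarrow> ell2" where
  "inverse_orbit T v j = (case j of 0 \<Rightarrow> T v | Suc i \<Rightarrow> (inv T ^^ i) v)"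

lemma inverse_orbit_simps [simp]:
  "inverse_orbit T v 0 = T v" "inverse_orbit T v (Suc 0) = v"
  by (simp_all add: inverse_orbit_def)

lemma inverse_orbit_step: "bij T \<Longrightarrow> T (inverse_orbit T v (Suc j)) = inverse_orbit T v j"
  by (cases j) (auto simp: inverse_orbit_def bij_is_surj surj_f_inv_f)

lemma norm_inverse_orbit_le:
  assumes "bij T" "bounded_linear T" "lower_norm T > 0"
  shows "norm (inverse_orbit T v (Suc j)) \<le> norm v / lower_norm T ^ j"
proof (induction j)
  case (Suc j)
  have "lower_norm T * norm (inverse_orbit T v (Suc (Suc j))) \<le> norm (inverse_orbit T v (Suc j))"
    using lower_norm_mult_le[OF assms(2), of "inverse_orbit T v (Suc (Suc j))"]
    by (simp only: inverse_orbit_step[OF assms(1)])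
  also have "\<dots> \<le> norm v / lower_norm T ^ j" by (rule Suc.IH)
  finally show ?case using assms(3) by (simp add: field_simps)
qed simp

text \<open>The combined vector \<open>y\<close> has residual below
  \<open>\<mu> * (1 + 2 * d)\<close>: one \<open>d\<close> from the choice of \<open>v\<close>, one
  from cutting the series at \<open>n\<close>. Its squared norm is at least \<open>1 + s\<close>,
  with \<open>s\<close> fixed before \<open>d\<close>. For small \<open>d\<close> the quotient falls
  below \<open>\<mu>\<close>. This replaces the maximum principle for the resolvent.\<close>

lemma lower_norm_not_locally_minimal:
  assumes T: "bounded_linear T" and bij: "bij T" and Tc: "\<And>z x. T (cscale z x) = cscale z (T x)"
    and r: "0 < r" "r < lower_norm T"
  shows "\<exists>z. norm z = r \<and> lower_norm (\<lambda>x. T x - cscale z x) < lower_norm T"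
proof -
  define \<mu> where "\<mu> = lower_norm T"
  have \<mu>: "\<mu> > 0" "r < \<mu>" using r by (auto simp: \<mu>_def)
  obtain K where K: "K > 0" "\<And>x. norm (T x) \<le> norm x * K"
    using bounded_linear.pos_bounded[OF T] by blast
  \<comment> \<open>A lower bound for the summand \<open>j = 1\<close>: since \<open>T\<close>
    expands by at most \<open>K\<close>, the vector preceding the unit vector \<open>v\<close> has
    norm at least \<open>1 / K\<close>.\<close>
  define s where "s = (r / K)\<^sup>2"
  have s: "s > 0" using r K by (simp add: s_def)
  \<comment> \<open>Chosen so that
    \<open>(1 + 2 * d)\<^sup>2 \<le> 1 + 8 * d < 1 + s\<close>.\<close>
  define d where "d = min 1 (s / 9)"
  have d: "d > 0" "d \<le> 1" "9 * d \<le> s" using s by (auto simp: d_def)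
  have "\<mu> < \<mu> * (1 + d)" using \<mu> d by simp
  then obtain v where v: "norm v = 1" "norm (T v) < \<mu> * (1 + d)"
    using lower_norm_approx unfolding \<mu>_def by blast
  obtain m where m: "(r / \<mu>) ^ m < d"
    using real_arch_pow_inv[of d "r / \<mu>"] \<mu> r d by auto
  \<comment> \<open>At least two summands are present, so the one producing \<open>s\<close> is
    included.\<close>
  define n where "n = Suc (Suc m)"
  define x where "x = inverse_orbit T v"
  have step: "T (x (Suc j)) = x j" for j unfolding x_def by (rule inverse_orbit_step[OF bij])
  have x0: "x 0 = T v" "x (Suc 0) = v" by (simp_all add: x_def)
  have q: "(r / \<mu>) ^ n < d"
  proof -
    have "(r / \<mu>) ^ n \<le> (r / \<mu>) ^ m" using r \<mu> by (intro power_decreasing) (auto simp: n_def)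
    then show ?thesis using m by simp
  qed
  have "norm (x n) \<le> 1 / \<mu> ^ Suc m"
    using norm_inverse_orbit_le[OF bij T, of v "Suc m"] \<mu> v by (simp add: x_def n_def \<mu>_def)
  then have "r ^ n * norm (x n) \<le> r ^ n * (1 / \<mu> ^ Suc m)" using r by (intro mult_left_mono) auto
  also have "\<dots> = \<mu> * (r / \<mu>) ^ n" using \<mu> by (simp add: n_def power_divide)
  also have "\<dots> < \<mu> * d" using q \<mu> by simp
  finally have xn: "r ^ n * norm (x n) < \<mu> * d" .
  obtain z y where zy: "norm z = r" "norm (T y - cscale z y) \<le> norm (x 0) + r ^ n * norm (x n)"
    "(\<Sum>j<n. r ^ (2 * j) * (norm (x (Suc j)))\<^sup>2) \<le> (norm y)\<^sup>2"
    using truncated_neumann_average[of n r T x] T Tc step r by (auto simp: n_def)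
  have up: "norm (T y - cscale z y) < \<mu> * (1 + 2 * d)"
    using zy(2) xn v(2) x0 by (simp add: algebra_simps)
  have "1 \<le> K * norm (x (Suc (Suc 0)))" using K(2)[of "x (Suc (Suc 0))"] step[of "Suc 0"] v x0
    by (simp add: mult.commute)
  then have "1 / K \<le> norm (x (Suc (Suc 0)))" using K(1) by (simp add: field_simps)
  then have "(1 / K)\<^sup>2 \<le> (norm (x (Suc (Suc 0))))\<^sup>2" using K(1) by (intro power_mono) auto
  then have "s \<le> r\<^sup>2 * (norm (x (Suc (Suc 0))))\<^sup>2"
    using mult_left_mono[of "(1 / K)\<^sup>2" _ "r\<^sup>2"] by (simp add: s_def power_divide)
  moreover have "(\<Sum>j<2. r ^ (2 * j) * (norm (x (Suc j)))\<^sup>2) \<le> (\<Sum>j<n. r ^ (2 * j) * (norm (x (Suc j)))\<^sup>2)"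
    using r by (intro sum_mono2) (auto simp: n_def)
  ultimately have y: "1 + s \<le> (norm y)\<^sup>2"
    using zy(3) x0 v by (simp add: numeral_2_eq_2)
  have "d * d \<le> d" using d by simp
  then have "(1 + 2 * d)\<^sup>2 \<le> 1 + 8 * d" by (simp add: power2_eq_square algebra_simps)
  also have "\<dots> < 1 + s" using d by linarith
  also note y
  finally have "(1 + 2 * d)\<^sup>2 < (norm y)\<^sup>2" .
  then have "1 + 2 * d < norm y" by (rule power2_less_imp_less) simp
  then have "\<mu> * (1 + 2 * d) < \<mu> * norm y" using \<mu> by simp
  then have "norm (T y - cscale z y) < \<mu> * norm y" using up by simp
  then have "lower_norm (\<lambda>x. T x - cscale z x) * norm y < \<mu> * norm y"
    using lower_norm_mult_le[OF bounded_linear_diff_cscale[OF T], of z y] by simp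
  then have "lower_norm (\<lambda>x. T x - cscale z x) < \<mu>"
    by (rule mult_right_less_imp_less) simp
  then show ?thesis using zy(1) by (auto simp: \<mu>_def)
qed

text \<open>Cauchy-Schwarz, with \<open>norm (S (x (Suc j))) = norm (x j)\<close> by the assumed
  equality of norms. It says that the quotients of consecutive norms along the orbit do not
  increase, so near-minimality of the first one is inherited by all.\<close>

lemma normal_orbit_log_convex:
  assumes adj: "adjoint_pair T S" and eq: "\<And>x. norm (S x) = norm (T x)"
    and step: "\<And>j. T (x (Suc j)) = x j"
  shows "(norm (x (Suc j)))\<^sup>2 \<le> norm (x j) * norm (x (Suc (Suc j)))"
proof -
  have "(norm (x (Suc j)))\<^sup>2 = inner (T (x (Suc (Suc j)))) (x (Suc j))"
    by (simp add: step power2_norm_eq_inner)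
  also have "\<dots> = inner (x (Suc (Suc j))) (S (x (Suc j)))" using adj by (simp add: adjoint_pair_def)
  also have "\<dots> \<le> norm (x (Suc (Suc j))) * norm (S (x (Suc j)))" by (rule norm_cauchy_schwarz)
  finally show ?thesis by (simp add: eq step mult.commute)
qed

text \<open>On the critical radius \<open>\<mu>\<close> the weighted norms along the orbit stay at
  least 1/2. Hence \<open>y\<close> has squared norm at least \<open>n / 4\<close>, while the
  residual stays below the fixed bound \<open>3 * \<mu>\<close>; large \<open>n\<close> makes the
  quotient small.\<close>

lemma normal_spectrum_on_circle:
  assumes adj: "adjoint_pair T S" and eq: "\<And>x. norm (S x) = norm (T x)"
    and bij: "bij T" and Tc: "\<And>z x. T (cscale z x) = cscale z (T x)" and d: "d > 0"
  shows "\<exists>z. norm z = lower_norm T \<and> lower_norm (\<lambda>x. T x - cscale z x) < d"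
proof -
  have T: "bounded_linear T" using adj by (simp add: adjoint_pair_def)
  define \<mu> where "\<mu> = lower_norm T"
  have \<mu>: "\<mu> > 0" using lower_norm_bij_adjoint(1)[OF adj bij] by (simp add: \<mu>_def)
  \<comment> \<open>From \<open>l * norm y \<le> 3 * \<mu>\<close> and
    \<open>real n / 4 \<le> (norm y)\<^sup>2\<close> one gets
    \<open>l\<^sup>2 * real n \<le> 36 * \<mu>\<^sup>2\<close>, whence the 36.\<close>
  obtain m :: nat where m: "36 * \<mu>\<^sup>2 / d\<^sup>2 < real m" using reals_Archimedean2 by blast
  define n where "n = Suc m"
  have n: "n > 0" "36 * \<mu>\<^sup>2 < d\<^sup>2 * real n"
    using m d by (auto simp: n_def field_simps) (smt (verit) zero_less_power2)
  \<comment> \<open>The relative error of \<open>v\<close> may be incurred once per step; this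
    choice keeps its \<open>n\<close>-th power equal to 2.\<close>
  define e where "e = root n 2"
  have e: "e > 1" "e ^ n = 2" using n by (auto simp: e_def)
  have ej: "e ^ j \<le> 2" if "j \<le> n" for j
    using power_increasing[OF that, of e] e by simp
  have "\<mu> < \<mu> * e" using \<mu> e by simp
  then obtain v where v: "norm v = 1" "norm (T v) < \<mu> * e"
    using lower_norm_approx unfolding \<mu>_def by blast
  define x where "x = inverse_orbit T v"
  have step: "T (x (Suc j)) = x j" for j unfolding x_def by (rule inverse_orbit_step[OF bij])
  have x0: "x 0 = T v" "x (Suc 0) = v" by (simp_all add: x_def)
  have ratio: "norm (x j) \<le> \<mu> * e * norm (x (Suc j))" for j
  proof (induction j)
    case (Suc j)
    have "norm (x (Suc j)) * norm (x (Suc j)) \<le> norm (x j) * norm (x (Suc (Suc j)))"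
      using normal_orbit_log_convex[of T S x j, OF adj eq step] by (simp add: power2_eq_square)
    also have "\<dots> \<le> \<mu> * e * norm (x (Suc j)) * norm (x (Suc (Suc j)))"
      by (intro mult_right_mono Suc.IH) simp
    finally have "norm (x (Suc j)) * norm (x (Suc j)) \<le> (\<mu> * e * norm (x (Suc (Suc j)))) * norm (x (Suc j))"
      by (simp add: mult_ac)
    then show ?case
      using \<mu> e by (cases "norm (x (Suc j)) = 0") (auto simp: mult_le_cancel_right)
  qed (use v x0 in simp)
  have low: "1 \<le> (\<mu> * e) ^ j * norm (x (Suc j))" for j
  proof (induction j)
    case (Suc j)
    have "(\<mu> * e) ^ j * norm (x (Suc j)) \<le> (\<mu> * e) ^ j * (\<mu> * e * norm (x (Suc (Suc j))))"
      using \<mu> e by (intro mult_left_mono ratio) auto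
    then show ?case using Suc.IH by (simp add: mult_ac)
  qed (use v x0 in simp)
  have summand: "1 / 4 \<le> \<mu> ^ (2 * j) * (norm (x (Suc j)))\<^sup>2" if "j < n" for j
  proof -
    have "1 \<le> e ^ j * (\<mu> ^ j * norm (x (Suc j)))" using low[of j] by (simp add: power_mult_distrib mult_ac)
    also have "\<dots> \<le> 2 * (\<mu> ^ j * norm (x (Suc j)))"
      using ej[of j] that \<mu> by (intro mult_right_mono) auto
    finally have "(1 / 2)\<^sup>2 \<le> (\<mu> ^ j * norm (x (Suc j)))\<^sup>2" by (intro power_mono) auto
    then show ?thesis by (simp add: power_mult_distrib power_mult[symmetric] power_divide mult.commute)
  qed
  obtain z y where zy: "norm z = \<mu>" "norm (T y - cscale z y) \<le> norm (x 0) + \<mu> ^ n * norm (x n)"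
    "(\<Sum>j<n. \<mu> ^ (2 * j) * (norm (x (Suc j)))\<^sup>2) \<le> (norm y)\<^sup>2"
    using truncated_neumann_average[of n \<mu> T x] T Tc step n \<mu> by auto
  have "(\<Sum>j<n. 1 / 4) \<le> (\<Sum>j<n. \<mu> ^ (2 * j) * (norm (x (Suc j)))\<^sup>2)"
    by (intro sum_mono summand) auto
  then have y: "real n / 4 \<le> (norm y)\<^sup>2" using zy(3) by simp
  have "norm (x n) \<le> 1 / \<mu> ^ m"
    using norm_inverse_orbit_le[OF bij T, of v m] \<mu> v by (simp add: x_def n_def \<mu>_def)
  then have "\<mu> ^ n * norm (x n) \<le> \<mu> ^ n * (1 / \<mu> ^ m)" using \<mu> by (intro mult_left_mono) auto
  also have "\<dots> = \<mu>" using \<mu> by (simp add: n_def)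
  finally have "\<mu> ^ n * norm (x n) \<le> \<mu>" .
  moreover have "norm (x 0) \<le> \<mu> * 2"
  proof -
    have "\<mu> * e \<le> \<mu> * 2" using ej[of 1] n \<mu> by simp
    then show ?thesis using v x0 by simp
  qed
  ultimately have up: "norm (T y - cscale z y) \<le> 3 * \<mu>" using zy(2) by simp
  define l where "l = lower_norm (\<lambda>x. T x - cscale z x)"
  have l0: "l \<ge> 0" unfolding l_def by (rule lower_norm_nonneg)
  have "l * norm y \<le> 3 * \<mu>"
    using lower_norm_mult_le[OF bounded_linear_diff_cscale[OF T], of z y] up by (simp add: l_def)
  then have "(l * norm y)\<^sup>2 \<le> (3 * \<mu>)\<^sup>2" using l0 by (intro power_mono) auto
  moreover have "l\<^sup>2 * (real n / 4) \<le> l\<^sup>2 * (norm y)\<^sup>2" using y by (intro mult_left_mono) auto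
  ultimately have "l\<^sup>2 * real n \<le> 36 * \<mu>\<^sup>2" by (simp add: power_mult_distrib)
  also have "\<dots> < d\<^sup>2 * real n" by (rule n)
  finally have "l\<^sup>2 < d\<^sup>2" using n by simp
  then have "l < d" by (rule power2_less_imp_less) (use d in simp)
  then show ?thesis using zy(1) by (auto simp: l_def \<mu>_def)
qed

section \<open>Hausdorff convergence of sublevel sets\<close>

text \<open>In \<open>ereal\<close> the supremum over the empty set is \<open>-\<infinity>\<close>,
  so the lower bound 0 is drawn from a point of \<open>S\<close>.\<close>

lemma hausdist_e_bounds:
  assumes "S \<noteq> {}" "\<And>x. x \<in> S \<Longrightarrow> infdist x T \<le> e" "\<And>y. y \<in> T \<Longrightarrow> infdist y S \<le> e"
  shows "0 \<le> hausdist_e S T" "hausdist_e S T \<le> ereal e"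
proof -
  obtain x where x: "x \<in> S" using assms(1) by blast
  have "0 \<le> ereal (infdist x T)" by (simp add: infdist_nonneg)
  also have "\<dots> \<le> (SUP x\<in>S. ereal (infdist x T))" by (rule SUP_upper[OF x])
  finally show "0 \<le> hausdist_e S T" by (simp add: hausdist_e_def le_max_iff_disj)
  have "(SUP x\<in>S. ereal (infdist x T)) \<le> ereal e" "(SUP y\<in>T. ereal (infdist y S)) \<le> ereal e"
    using assms by (auto intro!: SUP_least)
  then show "hausdist_e S T \<le> ereal e"
    by (simp add: hausdist_e_def le_max_iff_disj)
qed

lemma hausdist_e_tendsto_0I:
  assumes "\<And>e. e > 0 \<Longrightarrow> \<forall>\<^sub>F m in sequentially. S m \<noteq> {} \<and>
    (\<forall>x\<in>S m. infdist x T \<le> e) \<and> (\<forall>y\<in>T. infdist y (S m) \<le> e)"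
  shows "(\<lambda>m. hausdist_e (S m) T) \<longlonglongrightarrow> 0"
proof (rule order_tendstoI)
  fix a :: ereal assume "a < 0"
  have "\<forall>\<^sub>F m in sequentially. 0 \<le> hausdist_e (S m) T"
    using assms[of 1] by (rule eventually_mono) (auto intro!: hausdist_e_bounds(1)[where e=1])
  then show "\<forall>\<^sub>F m in sequentially. a < hausdist_e (S m) T"
    by (rule eventually_mono) (rule less_le_trans[OF \<open>a < 0\<close>])
next
  fix a :: ereal assume "0 < a"
  then obtain e where e: "0 < ereal e" "ereal e < a" using ereal_dense2 by blast
  have "\<forall>\<^sub>F m in sequentially. hausdist_e (S m) T \<le> ereal e"
    using assms[of e] e(1) by (auto elim!: eventually_mono intro: hausdist_e_bounds(2))
  then show "\<forall>\<^sub>F m in sequentially. hausdist_e (S m) T < a"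
    by (rule eventually_mono) (rule le_less_trans[OF _ e(2)])
qed

text \<open>The properties of \<open>z \<mapsto> 1 / \<parallel>(A - z)\<inverse>\<parallel>\<close> for a bounded operator \<open>A\<close> on a Hilbert space
  that make its sublevel sets depend continuously on it.\<close>

definition resolvent_like :: "real \<Rightarrow> (complex \<Rightarrow> real) \<Rightarrow> bool" where
  "resolvent_like K g \<longleftrightarrow> (\<forall>z. 0 \<le> g z \<and> norm z - K \<le> g z) \<and> (\<forall>z w. \<bar>g z - g w\<bar> \<le> dist z w)
    \<and> (\<forall>z e. g z > 0 \<longrightarrow> e > 0 \<longrightarrow> (\<exists>w. dist w z < e \<and> g w < g z))"

lemma resolvent_like_continuous_on: "resolvent_like K g \<Longrightarrow> continuous_on S g"
  by (rule lipschitz_on_continuous_on[where L=1])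
     (auto simp: resolvent_like_def lipschitz_on_def dist_real_def)

text \<open>Outside the disc of radius \<open>g 0 + K\<close> the growth bound gives values above
  \<open>g 0\<close>, so the minimum over the disc is global; it cannot be positive. For resolvents
  this is nonemptiness of the spectrum.\<close>

lemma resolvent_like_zero:
  assumes g: "resolvent_like K g"
  shows "\<exists>z. g z = 0"
proof -
  define R where "R = g 0 + K"
  have gK: "norm w - K \<le> g w" "0 \<le> g w" for w using g unfolding resolvent_like_def by blast+
  have R: "R \<ge> 0" using gK(1)[of 0] by (simp add: R_def)
  have "\<exists>z\<in>cball 0 R. \<forall>w\<in>cball 0 R. g z \<le> g w"
    by (rule continuous_attains_inf) (use R resolvent_like_continuous_on[OF g] in auto)
  then obtain z where z: "z \<in> cball 0 R" "\<And>w. w \<in> cball 0 R \<Longrightarrow> g z \<le> g w" by blast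
  have min: "g z \<le> g w" for w
  proof (cases "w \<in> cball 0 R")
    case False
    then have "g 0 \<le> g w" using gK(1)[of w] by (simp add: R_def)
    moreover have "g z \<le> g 0" using z(2)[of 0] R by simp
    ultimately show ?thesis by simp
  qed (rule z(2))
  have "\<not> g z > 0"
  proof
    assume "g z > 0"
    then obtain w where "g w < g z" using g zero_less_one unfolding resolvent_like_def by blast
    then show False using min[of w] by simp
  qed
  then have "g z = 0" using gK(2)[of z] by simp
  then show ?thesis by blast
qed

lemma resolvent_like_uniform:
  assumes f: "\<And>m. resolvent_like K (f m)" and g: "resolvent_like K g"
    and conv: "\<And>z. (\<lambda>m. f m z) \<longlonglongrightarrow> g z" and d: "d > 0"
  shows "\<forall>\<^sub>F m in sequentially. \<forall>z\<in>cball 0 R. \<bar>f m z - g z\<bar> < d"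
proof -
  obtain A :: "complex set" where A: "finite A" "cball 0 R \<subseteq> (\<Union>x\<in>A. ball x (d / 3))"
  proof -
    have sub: "cball 0 R \<subseteq> (\<Union>x\<in>cball (0::complex) R. ball x (d / 3))" using d by auto
    show ?thesis
      by (rule compactE_image[where f="\<lambda>x. ball x (d / 3)", OF compact_cball _ sub]) (use that in simp_all)
  qed
  have "\<forall>\<^sub>F m in sequentially. \<forall>x\<in>A. \<bar>f m x - g x\<bar> < d / 3"
  proof (rule eventually_ball_finite[OF A(1)], intro ballI)
    fix x assume "x \<in> A"
    show "\<forall>\<^sub>F m in sequentially. \<bar>f m x - g x\<bar> < d / 3"
      using tendstoD[OF conv[of x], of "d / 3"] d by (simp add: dist_real_def)
  qed
  then show ?thesis
  proof eventually_elim
    case (elim m)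
    show ?case
    proof
      fix z :: complex assume "z \<in> cball 0 R"
      then obtain x where x: "x \<in> A" "dist x z < d / 3" using A(2) by auto
      have "\<bar>f m z - f m x\<bar> \<le> dist z x" "\<bar>g z - g x\<bar> \<le> dist z x"
        using f[of m] g unfolding resolvent_like_def by blast+
      moreover have "\<bar>f m x - g x\<bar> < d / 3" using elim x by blast
      ultimately show "\<bar>f m z - g z\<bar> < d" using x(2) dist_commute[of z x] by linarith
    qed
  qed
qed

text \<open>Points of the limit set are caught by a finite net chosen inside it, where pointwise
  convergence suffices. Conversely, on the part \<open>Q\<close> of a large disc at distance at
  least \<open>e\<close> from the limit set, \<open>g\<close> exceeds \<epsilon> by a fixed margin,
  and uniform convergence keeps the approximating sets out of \<open>Q\<close>.\<close>

lemma hausdist_e_sublevel_tendsto: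
  assumes f: "\<And>m. resolvent_like K (f m)" and g: "resolvent_like K g"
    and conv: "\<And>z. (\<lambda>m. f m z) \<longlonglongrightarrow> g z" and eps: "\<epsilon> > 0"
  shows "(\<lambda>m. hausdist_e {z. f m z < \<epsilon>} {z. g z < \<epsilon>}) \<longlonglongrightarrow> 0"
proof (rule hausdist_e_tendsto_0I)
  fix e :: real assume e: "e > 0"
  define S where "S = {z. g z < \<epsilon>}"
  define R where "R = K + \<epsilon>"
  have inR: "z \<in> cball 0 R" if "h z < \<epsilon>" "resolvent_like K h" for h z
  proof -
    have "norm z - K \<le> h z" using that(2) unfolding resolvent_like_def by blast
    then show ?thesis using that(1) by (simp add: R_def)
  qed
  have ne: "{z. f m z < \<epsilon>} \<noteq> {}" for m
  proof -
    obtain z where "f m z = 0" using resolvent_like_zero[OF f[of m]] by blast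
    then have "z \<in> {z. f m z < \<epsilon>}" using eps by simp
    then show ?thesis by blast
  qed
  have "bounded S" using inR[OF _ g] by (intro bounded_subset[OF bounded_cball[of 0 R]]) (auto simp: S_def)
  then have "compact (closure S)" by simp
  then obtain A where A: "finite A" "A \<subseteq> S" "S \<subseteq> (\<Union>x\<in>A. ball x e)"
  proof -
    have sub: "closure S \<subseteq> (\<Union>x\<in>S. ball x e)" using e by (auto simp: closure_approachable)
    obtain A where "A \<subseteq> S" "finite A" "closure S \<subseteq> (\<Union>x\<in>A. ball x e)"
      by (rule compactE_image[where f="\<lambda>x. ball x e", OF \<open>compact (closure S)\<close> _ sub]) simp_all
    then show ?thesis using that[of A] closure_subset[of S] by blast
  qed
  have "\<forall>\<^sub>F m in sequentially. \<forall>x\<in>A. f m x < \<epsilon>"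
  proof (rule eventually_ball_finite[OF A(1)], intro ballI)
    fix x assume "x \<in> A"
    then have "g x < \<epsilon>" using A(2) by (auto simp: S_def)
    then show "\<forall>\<^sub>F m in sequentially. f m x < \<epsilon>" by (rule order_tendstoD(2)[OF conv])
  qed
  then have lower: "\<forall>\<^sub>F m in sequentially. \<forall>y\<in>S. infdist y {z. f m z < \<epsilon>} \<le> e"
  proof eventually_elim
    case (elim m)
    show ?case
    proof
      fix y assume "y \<in> S"
      then obtain x where "x \<in> A" "dist y x < e" using A(3) by (auto simp: dist_commute)
      then show "infdist y {z. f m z < \<epsilon>} \<le> e" using elim by (intro infdist_le2[of x]) auto
    qed
  qed
  define Q where "Q = cball 0 R \<inter> {z. e \<le> infdist z S}"
  have Q: "compact Q" unfolding Q_def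
    by (intro compact_Int_closed compact_cball closed_Collect_le continuous_intros)
  \<comment> \<open>The critical case is \<open>g z = \<epsilon>\<close>: as \<open>z\<close> is no
    local minimum, the sublevel set has a point within \<open>e\<close> of \<open>z\<close>,
    contradicting \<open>z \<in> Q\<close>.\<close>
  have gQ: "\<epsilon> < g z" if "z \<in> Q" for z
  proof (rule ccontr)
    assume "\<not> \<epsilon> < g z"
    have "\<exists>w. dist w z < e \<and> g w < \<epsilon>"
    proof (cases "g z < \<epsilon>")
      case False
      then have "g z = \<epsilon>" using \<open>\<not> \<epsilon> < g z\<close> by simp
      moreover have "g z > 0 \<longrightarrow> e > 0 \<longrightarrow> (\<exists>w. dist w z < e \<and> g w < g z)"
        using g unfolding resolvent_like_def by blast
      ultimately show ?thesis using e eps by auto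
    qed (use e in \<open>auto intro!: exI[of _ z]\<close>)
    then obtain w where "dist z w < e" "w \<in> S" by (auto simp: S_def dist_commute)
    then have "infdist z S < e" using infdist_le[of w S z] by simp
    then show False using that by (simp add: Q_def)
  qed
  have "\<exists>d>0. \<forall>z\<in>Q. \<epsilon> + d \<le> g z"
  proof (cases "Q = {}")
    case False
    then obtain z where z: "z \<in> Q" "\<And>w. w \<in> Q \<Longrightarrow> g z \<le> g w"
      using continuous_attains_inf[OF Q False resolvent_like_continuous_on[OF g]] by blast
    then show ?thesis using gQ[OF z(1)] by (intro exI[of _ "g z - \<epsilon>"]) auto
  qed (auto intro: exI[of _ 1])
  then obtain d where d: "d > 0" "\<And>z. z \<in> Q \<Longrightarrow> \<epsilon> + d \<le> g z" by blast
  have "\<forall>\<^sub>F m in sequentially. \<forall>z\<in>cball 0 R. \<bar>f m z - g z\<bar> < d"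
    by (rule resolvent_like_uniform[OF f g conv d(1)])
  then have upper: "\<forall>\<^sub>F m in sequentially. \<forall>x\<in>{z. f m z < \<epsilon>}. infdist x S \<le> e"
  proof eventually_elim
    case (elim m)
    show ?case
    proof
      fix x assume "x \<in> {z. f m z < \<epsilon>}"
      then have x: "f m x < \<epsilon>" "x \<in> cball 0 R" using inR[OF _ f[of m]] by auto
      then have "\<bar>f m x - g x\<bar> < d" using elim by blast
      then have "x \<notin> Q" using d(2)[of x] x(1) by auto
      then show "infdist x S \<le> e" using x(2) by (auto simp: Q_def)
    qed
  qed
  show "\<forall>\<^sub>F m in sequentially. {z. f m z < \<epsilon>} \<noteq> {} \<and> (\<forall>x\<in>{z. f m z < \<epsilon>}. infdist x {z. g z < \<epsilon>} \<le> e)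
      \<and> (\<forall>y\<in>{z. g z < \<epsilon>}. infdist y {z. f m z < \<epsilon>} \<le> e)"
    using lower upper unfolding S_def[symmetric] by eventually_elim (use ne in blast)
qed

text \<open>At a zero of one function the other is below \<open>e\<close> by uniform convergence on
  the disc, and the distance bounds turn a small value into a nearby zero.\<close>

lemma hausdist_e_zero_set_tendsto:
  assumes f: "\<And>m. resolvent_like K (f m)" and g: "resolvent_like K g"
    and conv: "\<And>z. (\<lambda>m. f m z) \<longlonglongrightarrow> g z"
    and fd: "\<And>m z. infdist z {w. f m w = 0} \<le> f m z" and gd: "\<And>z. infdist z {w. g w = 0} \<le> g z"
  shows "(\<lambda>m. hausdist_e {z. f m z = 0} {z. g z = 0}) \<longlonglongrightarrow> 0"
proof (rule hausdist_e_tendsto_0I)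
  fix e :: real assume e: "e > 0"
  have inK: "z \<in> cball 0 K" if "h z = 0" "resolvent_like K h" for h z
  proof -
    have "norm z - K \<le> h z" using that(2) unfolding resolvent_like_def by blast
    then show ?thesis using that(1) by simp
  qed
  have ne: "{z. f m z = 0} \<noteq> {}" for m using resolvent_like_zero[OF f[of m]] by blast
  have "\<forall>\<^sub>F m in sequentially. \<forall>z\<in>cball 0 K. \<bar>f m z - g z\<bar> < e"
    by (rule resolvent_like_uniform[OF f g conv e])
  then show "\<forall>\<^sub>F m in sequentially. {z. f m z = 0} \<noteq> {} \<and> (\<forall>x\<in>{z. f m z = 0}. infdist x {z. g z = 0} \<le> e)
      \<and> (\<forall>y\<in>{z. g z = 0}. infdist y {z. f m z = 0} \<le> e)"
  proof eventually_elim
    case (elim m)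
    have "infdist x {z. g z = 0} \<le> e" if "f m x = 0" for x
      using elim inK[OF that f[of m]] gd[of x] that by force
    moreover have "infdist y {z. f m z = 0} \<le> e" if "g y = 0" for y
      using elim inK[OF that g] fd[of y m] that by force
    ultimately show ?case using ne by simp
  qed
qed

section \<open>The operators of the theorem\<close>

lemma lower_norm_lipschitz:
  fixes T T' :: "ell2 \<Rightarrow> ell2"
  assumes "\<And>x. T' x = T x - cscale z x"
  shows "\<bar>lower_norm T - lower_norm T'\<bar> \<le> norm z"
proof -
  have "lower_norm T - norm z \<le> lower_norm T'"
  proof (rule lower_normI)
    fix x :: ell2 assume x: "norm x = 1"
    have "norm (T x) \<le> norm (T x - cscale z x) + norm (cscale z x)" by norm
    then show "lower_norm T - norm z \<le> norm (T' x)"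
      using lower_norm_le[OF x, of T] x by (simp add: assms)
  qed
  moreover have "lower_norm T' - norm z \<le> lower_norm T"
  proof (rule lower_normI)
    fix x :: ell2 assume x: "norm x = 1"
    have "norm (T x - cscale z x) \<le> norm (T x) + norm (cscale z x)" by norm
    then show "lower_norm T' - norm z \<le> norm (T x)"
      using lower_norm_le[OF x, of T'] x by (simp add: assms)
  qed
  ultimately show ?thesis by linarith
qed

lemma locally_similar_bounded_tendsto:
  assumes bnd: "\<And>m k n. norm (A m k n) \<le> C" "\<And>k n. norm (a k n) \<le> C"
    and sim: "\<And>N. \<forall>\<^sub>F m in sequentially. locally_similar w N (A m) a \<and> locally_similar w N a (A m)"
  shows "(\<lambda>m. lower_norm (bandT w (A m))) \<longlonglongrightarrow> lower_norm (bandT w a)"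
proof -
  define K where "K = 4 * real w * C\<^sup>2 * (real (2 * w + 1))\<^sup>2"
  let ?l = "\<lambda>a. (lower_norm (bandT w a))\<^sup>2"
  have "(\<lambda>m. ?l (A m)) \<longlonglongrightarrow> ?l a"
  proof (rule tendstoI)
    fix e :: real assume e: "e > 0"
    obtain N0 :: nat where N0: "K / e < real N0" using reals_Archimedean2 by blast
    define N where "N = Suc N0"
    have N: "N > 0" "K / real N < e"
    proof -
      have "K < e * real N0" using N0 e by (simp add: field_simps)
      also have "\<dots> \<le> e * real N" using e by (simp add: N_def)
      finally show "K / real N < e" by (simp add: N_def field_simps)
    qed (simp add: N_def)
    show "\<forall>\<^sub>F m in sequentially. dist (?l (A m)) (?l a) < e"
      using sim[of N]
    proof eventually_elim
      case (elim m)
      have "?l a \<le> ?l (A m) + K / real N"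
        using lower_norm_localized[of "A m" C a w N, OF bnd(1) bnd(2)] elim N by (simp add: K_def)
      moreover have "?l (A m) \<le> ?l a + K / real N"
        using lower_norm_localized[of a C "A m" w N, OF bnd(2) bnd(1)] elim N by (simp add: K_def)
      ultimately show ?case using N unfolding dist_real_def by linarith
    qed
  qed
  then have "(\<lambda>m. sqrt (?l (A m))) \<longlonglongrightarrow> sqrt (?l a)" by (rule tendsto_real_sqrt)
  then show ?thesis by (simp add: lower_norm_nonneg)
qed

lemma band_op_diff_scalar:
  assumes "\<And>k. a' k n = a k n - (if k = 0 then y else 0)"
  shows "band_op v a' x n = band_op v a x n - y * x n"
proof -
  have "band_op v a' x n = (\<Sum>k\<in>{-int v..int v}. a k n * x (n - k) - (if 0 = k then y * x n else 0))"
    unfolding band_op_def assms by (rule sum.cong) (auto simp: left_diff_distrib)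
  also have "\<dots> = band_op v a x n - y * x n"
    unfolding sum_subtractf band_op_def by simp
  finally show ?thesis .
qed

text \<open>The diagonals of \<open>L + S\<^sup>\<gamma> M\<^sub>u - z\<close>, where \<open>c k\<close> is the constant on the \<open>k\<close>-th diagonal of \<open>L\<close>.\<close>

definition hcoef :: "nat \<Rightarrow> (int \<Rightarrow> complex) \<Rightarrow> int \<Rightarrow> seq \<Rightarrow> complex \<Rightarrow> int \<Rightarrow> int \<Rightarrow> complex" where
  "hcoef w c \<gamma> u z k n = (if \<bar>k\<bar> \<le> int w then c k else 0) + (if k = \<gamma> then u (n - \<gamma>) else 0)
     - (if k = 0 then z else 0)"

definition hwidth :: "nat \<Rightarrow> int \<Rightarrow> nat" where "hwidth w \<gamma> = max w (nat \<bar>\<gamma>\<bar>)"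

definition hT :: "nat \<Rightarrow> (int \<Rightarrow> complex) \<Rightarrow> int \<Rightarrow> seq \<Rightarrow> complex \<Rightarrow> ell2 \<Rightarrow> ell2" where
  "hT w c \<gamma> u z = bandT (hwidth w \<gamma>) (hcoef w c \<gamma> u z)"

definition hS :: "nat \<Rightarrow> (int \<Rightarrow> complex) \<Rightarrow> int \<Rightarrow> seq \<Rightarrow> complex \<Rightarrow> ell2 \<Rightarrow> ell2" where
  "hS w c \<gamma> u z = bandT (hwidth w \<gamma>) (adj_coef (hcoef w c \<gamma> u z))"

text \<open>The reciprocal resolvent norm at \<open>z\<close>; see
  \<open>resolvent_norm_eq\<close>.\<close>

definition hmu :: "nat \<Rightarrow> (int \<Rightarrow> complex) \<Rightarrow> int \<Rightarrow> seq \<Rightarrow> complex \<Rightarrow> real" where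
  "hmu w c \<gamma> u z = min (lower_norm (hT w c \<gamma> u z)) (lower_norm (hS w c \<gamma> u z))"

text \<open>The sequence \<open>u\<close> enters only through \<open>B\<close>, so a single growth
  constant serves the limit and all approximating operators.\<close>

definition hbound :: "nat \<Rightarrow> (int \<Rightarrow> complex) \<Rightarrow> real \<Rightarrow> real" where
  "hbound w c B = (\<Sum>k\<in>{-int w..int w}. norm (c k)) + B"

lemma norm_hcoef_le:
  assumes "\<And>n. norm (u n) \<le> B"
  shows "norm (hcoef w c \<gamma> u z k n) \<le> hbound w c B + norm z"
proof -
  have B: "B \<ge> 0" using assms[of 0] norm_ge_zero order_trans by blast
  have 1: "norm (if \<bar>k\<bar> \<le> int w then c k else 0) \<le> (\<Sum>k\<in>{-int w..int w}. norm (c k))"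
  proof (cases "\<bar>k\<bar> \<le> int w")
    case True
    then have "k \<in> {-int w..int w}" by auto
    then show ?thesis
      using member_le_sum[of k "{-int w..int w}" "\<lambda>k. norm (c k)"] True by simp
  qed (simp add: sum_nonneg)
  have 2: "norm (if k = \<gamma> then u (n - \<gamma>) else 0) \<le> B" using assms B by auto
  have 3: "norm (if k = 0 then z else 0) \<le> norm z" by auto
  show ?thesis unfolding hcoef_def hbound_def
    by (rule order_trans[OF norm_triangle_ineq4]) (rule add_mono[OF order_trans[OF norm_triangle_ineq add_mono[OF 1 2]] 3])
qed

text \<open>Only the diagonal carrying \<open>u\<close> varies along its length, so matching the
  word of \<open>u\<close> seen by a window matches all coefficients there.\<close>

lemma locally_similar_hcoef:
  assumes "words N u \<subseteq> words N u'"
  shows "locally_similar w' N (hcoef w c \<gamma> u z) (hcoef w c \<gamma> u' z)"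
    and "locally_similar w' N (adj_coef (hcoef w c \<gamma> u z)) (adj_coef (hcoef w c \<gamma> u' z))"
proof -
  have ex: "\<exists>s. \<forall>n. p \<le> n \<and> n < p + int N \<longrightarrow> u' (n + s) = u n" for p
  proof -
    have "map (\<lambda>i. u (p + int i)) [0..<N] \<in> words N u'"
      by (rule subsetD[OF assms]) (unfold words_def, blast)
    then obtain q where "map (\<lambda>i. u (p + int i)) [0..<N] = map (\<lambda>i. u' (q + int i)) [0..<N]"
      unfolding words_def by blast
    then have q: "u (p + int i) = u' (q + int i)" if "i < N" for i
      using that by (auto simp: map_eq_conv)
    have "u' (n + (q - p)) = u n" if "p \<le> n" "n < p + int N" for n
      using q[of "nat (n - p)"] that by (simp add: algebra_simps)
    then show ?thesis by blast
  qed
  show "locally_similar w' N (hcoef w c \<gamma> u z) (hcoef w c \<gamma> u' z)"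
    unfolding locally_similar_def
  proof
    fix p
    obtain s where s: "\<And>n. p \<le> n \<and> n < p + int N \<longrightarrow> u' (n + s) = u n" using ex by blast
    have "hcoef w c \<gamma> u' z k (n + s) = hcoef w c \<gamma> u z k n" if "p \<le> n - k \<and> n - k < p + int N" for k n
      using s[of "n - k"] that by (auto simp: hcoef_def algebra_simps)
    then show "\<exists>s. \<forall>k\<in>{-int w'..int w'}. \<forall>n. p \<le> n - k \<and> n - k < p + int N \<longrightarrow>
      hcoef w c \<gamma> u' z k (n + s) = hcoef w c \<gamma> u z k n" by blast
  qed
  show "locally_similar w' N (adj_coef (hcoef w c \<gamma> u z)) (adj_coef (hcoef w c \<gamma> u' z))"
    unfolding locally_similar_def
  proof
    fix p
    \<comment> \<open>In the adjoint, \<open>u\<close> sits on diagonal \<open>- \<gamma>\<close>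
      and is read at \<open>n - k - \<gamma>\<close>; the word to match therefore starts at
      \<open>p - \<gamma>\<close>.\<close>
    obtain s where s: "\<And>n. p - \<gamma> \<le> n \<and> n < p - \<gamma> + int N \<longrightarrow> u' (n + s) = u n" using ex by blast
    have "adj_coef (hcoef w c \<gamma> u' z) k (n + s) = adj_coef (hcoef w c \<gamma> u z) k n"
      if "p \<le> n - k \<and> n - k < p + int N" for k n
      using s[of "n - k - \<gamma>"] that by (auto simp: adj_coef_def hcoef_def algebra_simps)
    then show "\<exists>s. \<forall>k\<in>{-int w'..int w'}. \<forall>n. p \<le> n - k \<and> n - k < p + int N \<longrightarrow>
      adj_coef (hcoef w c \<gamma> u' z) k (n + s) = adj_coef (hcoef w c \<gamma> u z) k n" by blast
  qed
qed

lemma hmu_tendsto: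
  assumes "\<And>n. norm (b n) \<le> B" "\<And>m n. norm (bs m n) \<le> B"
    and W: "\<forall>N. \<exists>m0. \<forall>m\<ge>m0. words N (bs m) = words N b"
  shows "(\<lambda>m. hmu w c \<gamma> (bs m) z) \<longlonglongrightarrow> hmu w c \<gamma> b z"
proof -
  let ?C = "hbound w c B + norm z"
  have ev: "\<forall>\<^sub>F m in sequentially. words N (bs m) = words N b" for N
    using W by (simp add: eventually_sequentially)
  have sim: "\<forall>\<^sub>F m in sequentially. locally_similar w' N (hcoef w c \<gamma> (bs m) z) (hcoef w c \<gamma> b z)
       \<and> locally_similar w' N (hcoef w c \<gamma> b z) (hcoef w c \<gamma> (bs m) z)" for N w'
    by (rule eventually_mono[OF ev[of N]]) (intro conjI locally_similar_hcoef, simp_all)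
  have sim': "\<forall>\<^sub>F m in sequentially. locally_similar w' N (adj_coef (hcoef w c \<gamma> (bs m) z)) (adj_coef (hcoef w c \<gamma> b z))
       \<and> locally_similar w' N (adj_coef (hcoef w c \<gamma> b z)) (adj_coef (hcoef w c \<gamma> (bs m) z))" for N w'
    by (rule eventually_mono[OF ev[of N]]) (intro conjI locally_similar_hcoef, simp_all)
  show ?thesis
    unfolding hmu_def hT_def hS_def
  proof (rule tendsto_min)
    show "(\<lambda>m. lower_norm (bandT (hwidth w \<gamma>) (hcoef w c \<gamma> (bs m) z)))
        \<longlonglongrightarrow> lower_norm (bandT (hwidth w \<gamma>) (hcoef w c \<gamma> b z))"
      by (rule locally_similar_bounded_tendsto[where C="?C"])
         (rule norm_hcoef_le assms sim)+
    show "(\<lambda>m. lower_norm (bandT (hwidth w \<gamma>) (adj_coef (hcoef w c \<gamma> (bs m) z))))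
        \<longlonglongrightarrow> lower_norm (bandT (hwidth w \<gamma>) (adj_coef (hcoef w c \<gamma> b z)))"
      by (rule locally_similar_bounded_tendsto[where C="?C"])
         (rule norm_hcoef_le norm_adj_coef_le assms sim')+
  qed
qed

section \<open>The reciprocal resolvent norm of a single operator\<close>

context
  fixes w :: nat and c :: "int \<Rightarrow> complex" and \<gamma> :: int and u :: seq and B :: real
  assumes u: "\<And>n. norm (u n) \<le> B"
begin

abbreviation "T \<equiv> hT w c \<gamma> u"
abbreviation "S \<equiv> hS w c \<gamma> u"
abbreviation "\<mu> \<equiv> hmu w c \<gamma> u"

lemma adjoint_pair_hT: "adjoint_pair (T z) (S z)"
  unfolding hT_def hS_def by (rule adjoint_pair_bandT) (rule norm_hcoef_le[OF u])

lemma bounded_linear_hT: "bounded_linear (T z)"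
  using adjoint_pair_hT by (auto simp: adjoint_pair_def)

lemma hT_cscale: "T z (cscale y x) = cscale y (T z x)"
  unfolding hT_def by (rule bandT_cscale[OF norm_hcoef_le[OF u]])

lemma hS_cscale: "S z (cscale y x) = cscale y (S z x)"
  unfolding hS_def by (rule bandT_cscale[OF norm_adj_coef_le[OF norm_hcoef_le[OF u]]])

lemma hT_shift: "T (z + y) x = T z x - cscale y x"
  unfolding hT_def
  by (rule ell2_eqI)
     (simp add: coord_bandT[OF norm_hcoef_le[OF u]], rule band_op_diff_scalar, simp add: hcoef_def)

lemma hS_shift: "S (z + y) x = S z x - cscale (cnj y) x"
  unfolding hS_def
  by (rule ell2_eqI)
     (simp add: coord_bandT[OF norm_adj_coef_le[OF norm_hcoef_le[OF u]]],
      rule band_op_diff_scalar, simp add: adj_coef_def hcoef_def)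

lemma bij_hT_iff: "bij (T z) \<longleftrightarrow> \<mu> z > 0"
proof
  assume "bij (T z)"
  from lower_norm_bij_adjoint[OF adjoint_pair_hT this] show "\<mu> z > 0" by (simp add: hmu_def)
next
  assume "\<mu> z > 0"
  then show "bij (T z)" by (intro bij_if_lower_norms_pos[OF adjoint_pair_hT]) (simp_all add: hmu_def)
qed

lemma hmu_eq_lower_norm:
  assumes "\<mu> z > 0"
  shows "lower_norm (T z) = \<mu> z"
proof -
  have "bij (T z)" using assms by (simp only: bij_hT_iff)
  from lower_norm_bij_adjoint(2)[OF adjoint_pair_hT this] show ?thesis by (simp add: hmu_def)
qed

lemma hmu_nonneg: "0 \<le> \<mu> z"
  by (simp add: hmu_def lower_norm_nonneg)

lemma hmu_le_lower_norm: "\<mu> z \<le> lower_norm (T z)"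
  by (simp add: hmu_def)

lemma hmu_lipschitz: "\<bar>\<mu> z - \<mu> y\<bar> \<le> dist z y"
proof -
  have "\<bar>lower_norm (T y) - lower_norm (T z)\<bar> \<le> norm (z - y)"
    by (rule lower_norm_lipschitz) (use hT_shift[of y "z - y"] in simp)
  moreover have "\<bar>lower_norm (S y) - lower_norm (S z)\<bar> \<le> norm (cnj (z - y))"
    by (rule lower_norm_lipschitz) (use hS_shift[of y "z - y"] in simp)
  ultimately show ?thesis unfolding hmu_def dist_norm complex_mod_cnj by linarith
qed

lemma hmu_growth: "norm z - hbound w c B * real (2 * hwidth w \<gamma> + 1) \<le> \<mu> z"
proof -
  let ?K = "hbound w c B * real (2 * hwidth w \<gamma> + 1)"
  have bnd: "norm (hcoef w c \<gamma> u 0 k n) \<le> hbound w c B" for k n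
    using norm_hcoef_le[of u B w c \<gamma> 0 k n, OF u] by simp
  have "norm z - ?K \<le> lower_norm (T z)"
  proof (rule lower_normI)
    fix x :: ell2 assume x: "norm x = 1"
    have "norm (T 0 x) \<le> ?K"
      using norm_bandT_le[of "hcoef w c \<gamma> u 0" _ "hwidth w \<gamma>" x, OF bnd] x by (simp add: hT_def)
    moreover have "T z x = T 0 x - cscale z x" using hT_shift[of 0 z x] by simp
    moreover have "norm (cscale z x) \<le> norm (T 0 x) + norm (T 0 x - cscale z x)" by norm
    ultimately show "norm z - ?K \<le> norm (T z x)" using x by simp
  qed
  moreover have "norm z - ?K \<le> lower_norm (S z)"
  proof (rule lower_normI)
    fix x :: ell2 assume x: "norm x = 1"
    have "norm (S 0 x) \<le> ?K"
      using norm_bandT_le[of "adj_coef (hcoef w c \<gamma> u 0)" _ "hwidth w \<gamma>" x, OF norm_adj_coef_le[OF bnd]] x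
      by (simp add: hS_def)
    moreover have "S z x = S 0 x - cscale (cnj z) x" using hS_shift[of 0 z x] by simp
    moreover have "norm (cscale (cnj z) x) \<le> norm (S 0 x) + norm (S 0 x - cscale (cnj z) x)" by norm
    ultimately show "norm z - ?K \<le> norm (S z x)" using x by simp
  qed
  ultimately show ?thesis by (simp add: hmu_def)
qed

lemma hT_shift_fun: "T (z + y) = (\<lambda>x. T z x - cscale y x)"
  using hT_shift by blast

text \<open>Where \<open>\<mu> z\<close> is positive the operator is invertible and
  \<open>\<mu> z\<close> is its lower norm. Some shift of modulus \<open>r\<close> lowers the lower
  norm, and \<open>\<mu>\<close> never exceeds it.\<close>

lemma resolvent_like_hmu: "resolvent_like (hbound w c B * real (2 * hwidth w \<gamma> + 1)) \<mu>"
  unfolding resolvent_like_def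
proof (intro conjI allI impI)
  fix z and e :: real assume z: "\<mu> z > 0" and e: "e > 0"
  define r where "r = min (e / 2) (\<mu> z / 2)"
  have r: "0 < r" "r < e" "r < \<mu> z" using z e by (auto simp: r_def)
  have "bij (T z)" using z by (simp only: bij_hT_iff)
  then obtain y where y: "norm y = r" "lower_norm (\<lambda>x. T z x - cscale y x) < \<mu> z"
    using lower_norm_not_locally_minimal[OF bounded_linear_hT _ hT_cscale r(1), of z]
      hmu_eq_lower_norm[OF z] r by auto
  then have "\<mu> (z + y) < \<mu> z"
    using hmu_le_lower_norm[of "z + y"] unfolding hT_shift_fun by linarith
  moreover have "dist (z + y) z < e" using y r by (simp add: dist_norm)
  ultimately show "\<exists>w. dist w z < e \<and> \<mu> w < \<mu> z" by blast
qed (rule hmu_nonneg hmu_growth hmu_lipschitz)+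

text \<open>On the circle of radius \<open>\<mu> z\<close> about \<open>z\<close> the function takes
  values below every positive \<open>d\<close>; by compactness it has a zero there, at distance
  exactly \<open>\<mu> z\<close>.\<close>

lemma infdist_zero_set_le_hmu:
  assumes normal: "\<And>z x. norm (S z x) = norm (T z x)"
  shows "infdist z {y. \<mu> y = 0} \<le> \<mu> z"
proof (cases "\<mu> z = 0")
  case False
  then have z: "\<mu> z > 0" using hmu_nonneg[of z] by simp
  have bij: "bij (T z)" using z by (simp only: bij_hT_iff)
  have "sphere z (\<mu> z) \<noteq> {}" using z by simp
  then obtain y where y: "y \<in> sphere z (\<mu> z)" "\<And>y'. y' \<in> sphere z (\<mu> z) \<Longrightarrow> \<mu> y \<le> \<mu> y'"
    using continuous_attains_inf[OF compact_sphere _ resolvent_like_continuous_on[OF resolvent_like_hmu]]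
    by metis
  have "\<mu> y \<le> d" if d: "d > 0" for d
  proof -
    obtain v where v: "norm v = \<mu> z" "lower_norm (\<lambda>x. T z x - cscale v x) < d"
      using normal_spectrum_on_circle[OF adjoint_pair_hT normal bij hT_cscale d]
        hmu_eq_lower_norm[OF z] by auto
    have "z + v \<in> sphere z (\<mu> z)" using v by (simp add: dist_norm)
    then have "\<mu> y \<le> \<mu> (z + v)" by (rule y(2))
    also have "\<dots> \<le> lower_norm (T (z + v))" by (rule hmu_le_lower_norm)
    also have "\<dots> \<le> d" using v unfolding hT_shift_fun by simp
    finally show ?thesis .
  qed
  then have "\<mu> y \<le> 0" by (rule field_le_epsilon[of _ 0, simplified])
  then have "\<mu> y = 0" using hmu_nonneg[of y] by simp
  then show ?thesis using y(1) by (intro infdist_le2[of y]) auto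
qed (simp add: infdist_nonneg)

lemma coord_hT:
  assumes L: "\<And>x n. x \<in> l2 \<Longrightarrow> L x n = (\<Sum>k\<in>{-int w..int w}. c k * x (n - k))"
  shows "coord (T z x) = shift_op (H_op L \<gamma> u) z (coord x)"
proof
  fix n
  let ?W = "{- int (hwidth w \<gamma>)..int (hwidth w \<gamma>)}" and ?x = "coord x"
  have sub: "{-int w..int w} \<subseteq> ?W" by (auto simp: hwidth_def)
  have 1: "(\<Sum>k\<in>?W. if \<bar>k\<bar> \<le> int w then c k * ?x (n - k) else 0) = L ?x n"
    unfolding L[OF coord] by (rule sum.mono_neutral_cong_right[OF _ sub]) auto
  have "\<gamma> \<in> ?W" by (auto simp: hwidth_def)
  then have 2: "(\<Sum>k\<in>?W. if \<gamma> = k then u (n - \<gamma>) * ?x (n - \<gamma>) else 0) = u (n - \<gamma>) * ?x (n - \<gamma>)"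
    by simp
  have 3: "(\<Sum>k\<in>?W. if 0 = k then z * ?x n else 0) = z * ?x n" by simp
  have "coord (T z x) n = (\<Sum>k\<in>?W. (if \<bar>k\<bar> \<le> int w then c k * ?x (n - k) else 0)
      + (if \<gamma> = k then u (n - \<gamma>) * ?x (n - \<gamma>) else 0) - (if 0 = k then z * ?x n else 0))"
    unfolding hT_def coord_bandT[OF norm_hcoef_le[OF u]] band_op_def
    by (rule sum.cong) (auto simp: hcoef_def algebra_simps)
  also have "\<dots> = shift_op (H_op L \<gamma> u) z ?x n"
    unfolding sum_subtractf sum.distrib 1 2 3 by (simp add: shift_op_def H_op_def shift_def mult_op_def)
  finally show "coord (T z x) n = shift_op (H_op L \<gamma> u) z ?x n" .
qed

text \<open>The operator \<open>T'\<close> witnessing normality must coincide with the band adjoint,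
  as the inner product determines it. This gives equal norms at \<open>z = 0\<close>; for other
  \<open>z\<close> the squares are expanded.\<close>

lemma norm_hS_eq_norm_hT:
  assumes L: "\<And>x n. x \<in> l2 \<Longrightarrow> L x n = (\<Sum>k\<in>{-int w..int w}. c k * x (n - k))"
    and normal: "is_normal_op (H_op L \<gamma> u)"
  shows "norm (S z x) = norm (T z x)"
proof -
  from normal[unfolded is_normal_op_def] obtain T' :: op where
    T': "(\<forall>x\<in>l2. T' x \<in> l2) \<and> (\<forall>x\<in>l2. \<forall>y\<in>l2. l2inner (H_op L \<gamma> u x) y = l2inner x (T' y))
      \<and> (\<forall>x\<in>l2. H_op L \<gamma> u (T' x) = T' (H_op L \<gamma> u x))" ..
  note T' = conjunct1[OF T'] conjunct1[OF conjunct2[OF T']] conjunct2[OF conjunct2[OF T']]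
  have T0: "coord (T 0 x) = H_op L \<gamma> u (coord x)" for x
    using coord_hT[of L 0 x, OF L] by (simp add: shift_op_def)
  have inner: "inner x y = Re (l2inner (coord x) (coord y))" for x y
    unfolding l2inner_def infsum_Re[OF summable_l2_prod[OF coord coord], symmetric] inner_ell2_def
    by (simp add: inner_complex_def)
  have S0: "coord (S 0 y) = T' (coord y)" for y
  proof -
    define y' where "y' = Abs_ell2 (T' (coord y))"
    have y': "coord y' = T' (coord y)" unfolding y'_def by (rule Abs_ell2_inverse) (rule bspec[OF T'(1) coord])
    have "inner x (S 0 y) = inner x y'" for x
    proof -
      have "inner x (S 0 y) = inner (T 0 x) y" using adjoint_pair_hT[of 0] by (simp add: adjoint_pair_def)
      also have "\<dots> = inner x y'"
        unfolding inner T0 y' bspec[OF bspec[OF T'(2) coord] coord] ..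
      finally show ?thesis .
    qed
    then have "S 0 y = y'" using vector_eq_ldot[of "S 0 y" y'] by blast
    then show ?thesis by (simp add: y')
  qed
  have "T 0 (S 0 x) = S 0 (T 0 x)"
    unfolding coord_inject[symmetric] T0 S0 by (rule bspec[OF T'(3) coord])
  moreover have TS: "inner (T 0 x) y = inner x (S 0 y)" for x y
    using adjoint_pair_hT[of 0] by (simp add: adjoint_pair_def)
  moreover have ST: "inner (S 0 x) y = inner x (T 0 y)" for x y
    unfolding inner_commute[of "S 0 x"] TS[symmetric] by (rule inner_commute)
  ultimately have "inner (T 0 x) (T 0 x) = inner (S 0 x) (S 0 x)" by simp
  then have 0: "(norm (T 0 x))\<^sup>2 = (norm (S 0 x))\<^sup>2" by (simp add: power2_norm_eq_inner)
  \<comment> \<open>The mixed terms of the two expansions agree because \<open>S 0\<close> commutes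
    with complex scalars.\<close>
  have "inner (S 0 x) (cscale (cnj z) x) = inner (cscale z (S 0 x)) x"
    by (rule inner_cscale[symmetric])
  also have "\<dots> = inner (S 0 (cscale z x)) x" by (simp add: hS_cscale)
  also have "\<dots> = inner (T 0 x) (cscale z x)" unfolding ST by (rule inner_commute)
  finally have i: "inner (S 0 x) (cscale (cnj z) x) = inner (T 0 x) (cscale z x)" .
  have sq: "(norm (a - b))\<^sup>2 = (norm a)\<^sup>2 - 2 * inner a b + (norm b)\<^sup>2" for a b :: ell2
    unfolding power2_norm_eq_inner by (simp add: inner_diff_left inner_diff_right inner_commute)
  have "S z x = S 0 x - cscale (cnj z) x" "T z x = T 0 x - cscale z x"
    using hT_shift[of 0 z x] hS_shift[of 0 z x] by simp_all
  then have "(norm (S z x))\<^sup>2 = (norm (T z x))\<^sup>2"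
    by (simp only: sq 0 i norm_cscale complex_mod_cnj)
  then show ?thesis by simp
qed

lemma resolvent_norm_eq:
  assumes L: "\<And>x n. x \<in> l2 \<Longrightarrow> L x n = (\<Sum>k\<in>{-int w..int w}. c k * x (n - k))"
  shows "resolvent_norm (H_op L \<gamma> u) z = inverse (ereal (\<mu> z))"
  unfolding resolvent_norm_def hmu_def
  using coord_hT[of L z, OF L] by (rule inv_norm_eq[of "T z" _ "S z", OF _ adjoint_pair_hT])

lemma l2_spectrum_eq:
  assumes L: "\<And>x n. x \<in> l2 \<Longrightarrow> L x n = (\<Sum>k\<in>{-int w..int w}. c k * x (n - k))"
  shows "l2_spectrum (H_op L \<gamma> u) = {z. \<mu> z = 0}"
proof -
  have "bij_betw (shift_op (H_op L \<gamma> u) z) l2 l2 \<longleftrightarrow> \<mu> z \<noteq> 0" for z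
  proof -
    have "bij_betw (shift_op (H_op L \<gamma> u) z) l2 l2 \<longleftrightarrow> bij (T z)"
      using coord_hT[of L z, OF L] by (rule bij_betw_l2_iff)
    then show ?thesis using hmu_nonneg[of z] by (simp only: bij_hT_iff) linarith
  qed
  then show ?thesis by (simp add: l2_spectrum_def)
qed

lemma pseudospectrum_eq:
  assumes L: "\<And>x n. x \<in> l2 \<Longrightarrow> L x n = (\<Sum>k\<in>{-int w..int w}. c k * x (n - k))" and "\<epsilon> > 0"
  shows "pseudospectrum (H_op L \<gamma> u) \<epsilon> = {z. \<mu> z < \<epsilon>}"
proof -
  have "ereal (1 / \<epsilon>) < inverse (ereal (\<mu> z)) \<longleftrightarrow> \<mu> z < \<epsilon>" for z
  proof (cases "\<mu> z = 0")
    case False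
    then have "\<mu> z > 0" using hmu_nonneg[of z] by simp
    then show ?thesis using \<open>\<epsilon> > 0\<close> by (simp add: divide_simps)
  qed (use \<open>\<epsilon> > 0\<close> in simp)
  moreover have "resolvent_norm (H_op L \<gamma> u) z = inverse (ereal (\<mu> z))" for z
    by (rule resolvent_norm_eq[of L, OF L])
  ultimately show ?thesis by (simp only: pseudospectrum_def)
qed

end

text \<open>Unit vectors read off single matrix entries, and commuting with the shift identifies
  neighbouring entries of a diagonal.\<close>

lemma shift_invariant_band_op:
  assumes "is_bounded_band_op L" and comm: "\<forall>x\<in>l2. L (shift 1 x) = shift 1 (L x)"
  shows "\<exists>w c. \<forall>x n. L x n = (\<Sum>k\<in>{-int w..int w}. c k * x (n - k))"
proof -
  obtain w a where L: "L = band_op w a" using assms(1) by (auto simp: is_bounded_band_op_def)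
  have at_delta: "L (coord (delta j)) n = a (n - j) n" if "\<bar>n - j\<bar> \<le> int w" for j n
  proof -
    have "L (coord (delta j)) n = (\<Sum>k\<in>{-int w..int w}. if k = n - j then a (n - j) n else 0)"
      unfolding L band_op_def by (rule sum.cong) (auto simp: coord_delta)
    then show ?thesis using that by (auto simp: sum.delta)
  qed
  have step: "a k n = a k (n - 1)" if k: "\<bar>k\<bar> \<le> int w" for k n
  proof -
    have "coord (delta (n - k)) = shift 1 (coord (delta (n - 1 - k)))"
      by (rule ext) (simp add: shift_def coord_delta algebra_simps)
    then have "L (coord (delta (n - k))) n = shift 1 (L (coord (delta (n - 1 - k)))) n"
      using comm[rule_format, OF coord, of "delta (n - 1 - k)"] by simp
    then show ?thesis using at_delta[of n "n - k"] at_delta[of "n - 1" "n - 1 - k"] k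
      by (simp add: shift_def)
  qed
  have const: "a k n = a k 0" if k: "\<bar>k\<bar> \<le> int w" for k n
  proof (induction n rule: int_induct[where k=0])
    case (step1 i)
    then show ?case using step[OF k, of "i + 1"] by simp
  next
    case (step2 i)
    then show ?case using step[OF k, of i] by simp
  qed simp
  have "L x n = (\<Sum>k\<in>{-int w..int w}. a k 0 * x (n - k))" for x n
    unfolding L band_op_def
  proof (rule sum.cong)
    fix k assume "k \<in> {-int w..int w}"
    then have "\<bar>k\<bar> \<le> int w" by auto
    from const[OF this, of n] show "a k n * x (n - k) = a k 0 * x (n - k)" by simp
  qed simp
  then show ?thesis by (intro exI[of _ w] exI[of _ "\<lambda>k. a k 0"] allI)
qed

theorem theorem4p10:
  fixes Sig :: "complex set" and L :: op and \<gamma> :: int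
    and b :: seq and bs :: "nat \<Rightarrow> seq"
  assumes "compact Sig" and "Sig \<noteq> {}"
    and "is_bounded_band_op L"
    and "\<forall>x\<in>l2. L (shift 1 x) = shift 1 (L x)"
    and "\<forall>n. b n \<in> Sig"
    and "\<forall>m n. bs m n \<in> Sig"
    and "\<forall>N. \<exists>m0. \<forall>m\<ge>m0. words N (bs m) = words N b"
  shows "(\<forall>z \<epsilon>. \<epsilon> > 0 \<longrightarrow>
            ((\<lambda>m. resolvent_norm (H_op L \<gamma> (bs m)) z)
               \<longlonglongrightarrow> resolvent_norm (H_op L \<gamma> b) z) \<and>
            ((\<lambda>m. hausdist_e (pseudospectrum (H_op L \<gamma> (bs m)) \<epsilon>)
                              (pseudospectrum (H_op L \<gamma> b) \<epsilon>)) \<longlonglongrightarrow> 0))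
       \<and> ((\<forall>m. is_normal_op (H_op L \<gamma> (bs m))) \<and> is_normal_op (H_op L \<gamma> b) \<longrightarrow>
            (\<lambda>m. hausdist_e (l2_spectrum (H_op L \<gamma> (bs m)))
                             (l2_spectrum (H_op L \<gamma> b))) \<longlonglongrightarrow> 0)"
proof -
  have L: "\<exists>w c. \<forall>x n. L x n = (\<Sum>k\<in>{-int w..int w}. c k * x (n - k))"
    by (rule shift_invariant_band_op) fact+
  then obtain w c where "\<forall>x n. L x n = (\<Sum>k\<in>{-int w..int w}. c k * x (n - k))" by blast
  then have L: "x \<in> l2 \<Longrightarrow> L x n = (\<Sum>k\<in>{-int w..int w}. c k * x (n - k))" for x n by blast
  obtain B where B: "\<And>s. s \<in> Sig \<Longrightarrow> norm s \<le> B"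
    using compact_imp_bounded[OF \<open>compact Sig\<close>] by (auto simp: bounded_iff)
  have b: "norm (b n) \<le> B" and bs: "norm (bs m n) \<le> B" for m n
    using assms(5,6) by (auto intro: B)
  define f where "f m = hmu w c \<gamma> (bs m)" for m
  define g where "g = hmu w c \<gamma> b"
  have conv: "(\<lambda>m. f m z) \<longlonglongrightarrow> g z" for z
    unfolding f_def g_def by (rule hmu_tendsto) (fact b bs assms(7))+
  have f: "resolvent_like (hbound w c B * real (2 * hwidth w \<gamma> + 1)) (f m)" for m
    unfolding f_def by (rule resolvent_like_hmu) (rule bs)
  have g: "resolvent_like (hbound w c B * real (2 * hwidth w \<gamma> + 1)) g"
    unfolding g_def by (rule resolvent_like_hmu) (rule b)
  have res_f: "resolvent_norm (H_op L \<gamma> (bs m)) z = inverse (ereal (f m z))"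
    and ps_f: "\<epsilon> > 0 \<Longrightarrow> pseudospectrum (H_op L \<gamma> (bs m)) \<epsilon> = {z. f m z < \<epsilon>}"
    and spec_f: "l2_spectrum (H_op L \<gamma> (bs m)) = {z. f m z = 0}" for m z \<epsilon>
    unfolding f_def
    by (rule resolvent_norm_eq[OF bs L] pseudospectrum_eq[OF bs L] l2_spectrum_eq[OF bs L]; assumption)+
  have res_g: "resolvent_norm (H_op L \<gamma> b) z = inverse (ereal (g z))"
    and ps_g: "\<epsilon> > 0 \<Longrightarrow> pseudospectrum (H_op L \<gamma> b) \<epsilon> = {z. g z < \<epsilon>}"
    and spec_g: "l2_spectrum (H_op L \<gamma> b) = {z. g z = 0}" for z \<epsilon>
    unfolding g_def
    by (rule resolvent_norm_eq[OF b L] pseudospectrum_eq[OF b L] l2_spectrum_eq[OF b L]; assumption)+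
  have res: "(\<lambda>m. resolvent_norm (H_op L \<gamma> (bs m)) z) \<longlonglongrightarrow> resolvent_norm (H_op L \<gamma> b) z" for z
    unfolding res_f res_g
  \<comment> \<open>Inversion is continuous at 0 only from the nonnegative side; this covers
    resolvent norms tending to \<open>\<infinity>\<close> at spectral points of the limit.\<close>
  proof (rule Extended_Real.tendsto_inverse_ereal)
    show "(\<lambda>m. ereal (f m z)) \<longlonglongrightarrow> ereal (g z)" using conv by simp
    show "\<forall>\<^sub>F m in sequentially. 0 \<le> ereal (f m z)"
      using f unfolding resolvent_like_def by simp
  qed
  have ps: "(\<lambda>m. hausdist_e (pseudospectrum (H_op L \<gamma> (bs m)) \<epsilon>) (pseudospectrum (H_op L \<gamma> b) \<epsilon>)) \<longlonglongrightarrow> 0"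
    if "\<epsilon> > 0" for \<epsilon>
    unfolding ps_f[OF that] ps_g[OF that]
    by (rule hausdist_e_sublevel_tendsto[OF f g conv that])
  have sp: "(\<lambda>m. hausdist_e (l2_spectrum (H_op L \<gamma> (bs m))) (l2_spectrum (H_op L \<gamma> b))) \<longlonglongrightarrow> 0"
    if n: "\<forall>m. is_normal_op (H_op L \<gamma> (bs m))" "is_normal_op (H_op L \<gamma> b)"
  proof -
    have "infdist z {y. f m y = 0} \<le> f m z" for m z
      unfolding f_def
      by (rule infdist_zero_set_le_hmu[OF bs norm_hS_eq_norm_hT[OF bs L]]) (simp_all add: n)
    moreover have "infdist z {y. g y = 0} \<le> g z" for z
      unfolding g_def
      by (rule infdist_zero_set_le_hmu[OF b norm_hS_eq_norm_hT[OF b L]]) (simp_all add: n)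
    ultimately show ?thesis
      unfolding spec_f spec_g
      by (rule hausdist_e_zero_set_tendsto[OF f g conv])
  qed
  show ?thesis using res ps sp by blast
qed

end
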